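(* Let $X=(X_t)_{t\in T}$ be an infinitely divisible process with a $\sigma$-finite Lévy measure $\nu$. Assume that the paths of $X$ lie in a set $U\subset\mathbb{R}^T$ that is a standard Borel space for the $\sigma$-algebra $\mathcal{U}=\mathcal{B}^T\cap U=\{A\cap U:A\in\mathcal{B}^T\}$, and also that $U$ is an algebraic subgroup of $\mathbb{R}^T$ under addition. Then $\nu$ is concentrated on $U$ in the sense that $\nu_*(\mathbb{R}^T\setminus U)=0$. Therefore, $\nu$ is well defined on $\mathcal{U}$ (by $\nu(A\cap U):=\nu(A)$, $A\in\mathcal{B}^T$), and the evaluation process $(u\mapsto u(t))_{t\in T}$ on $(U,\mathcal{U},\nu)$ is an exact representation of $\nu$ and has paths in $U$. Moreover, any representation $V=(V_t)_{t\in T}$ of $\nu$, given on a $\sigma$-finite measure space $(S,\mathcal{S},n)$, can be modified to an exact representation $\widetilde V=(\widetilde V_t)_{t\in T}$ of $\nu$ with paths in $U$ and such that $n\{s:\widetilde V_t(s)\ne V_t(s)\}=0$ for every $t\in T$.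
   Context: $T$ is an arbitrary nonempty set, $\mathbb{R}^T$ the space of all functions $x:T\to\mathbb{R}$, $\mathcal{B}^T$ its cylindrical (product) $\sigma$-algebra, $x_I$ the restriction of $x$ to $I\subset T$, $0_I$ the origin of $\mathbb{R}^I$, $\pi_I(x)=x_I$, $\mathcal{B}_0^I=\{B\in\mathcal{B}^I:0_I\notin B\}$. Inner measure: $\nu_*(E)=\sup\{\nu(D):D\subset E,\ D\in\mathcal{B}^T\}$. A measure $\nu$ on $(\mathbb{R}^T,\mathcal{B}^T)$ is a Lévy measure if (L1) $\int|x(t)|^2\wedge1\,\nu(dx)<\infty$ for every $t\in T$, and (L2) $\nu(A)=\nu_*(A\setminus\{0_T\})$ for every $A\in\mathcal{B}^T$. A process $X$ is infinitely divisible if all its finite-dimensional distributions are. Its Lévy measure is the unique Lévy measure $\nu$ on $(\mathbb{R}^T,\mathcal{B}^T)$ such that, for a (symmetric) non-negative definite $\Sigma$ on $T\times T$, some $b\in\mathbb{R}^T$, all finite nonempty $I\subset T$ and $a\in\mathbb{R}^I$, $$\mathbb{E}e^{i\sum_{t\in I}a_tX_t}=\exp\Big\{-\tfrac12\sum_{s,t\in I}a_sa_t\Sigma(s,t)+\int_{\mathbb{R}^T}\Big(e^{i\sum_{t\in I}a_tx(t)}-1-i\sum_{t\in I}a_tx(t)\mathbf{1}_{\{|x(t)|\le1\}}\Big)\nu(dx)+i\sum_{t\in I}a_tb(t)\Big\}.$$ A representation of $\nu$ is a collection $V=(V_t)_{t\in T}$ of measurable real functions on a measure space $(S,\mathcal{S},n)$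 such that $n\{s:V_I(s)\in B\}=\nu(\pi_I^{-1}(B))$ for every finite nonempty $I\subset T$ and $B\in\mathcal{B}_0^I$, where $V_I=(V_t)_{t\in I}$. It is exact if $n\circ V^{-1}=\nu$ on $\mathcal{B}^T$ (equivalently, $n\circ V^{-1}$ satisfies (L2)), where $V$ is viewed as the map $S\to\mathbb{R}^T$, $V(s)(t)=V_t(s)$; its paths are the functions $V(s)$, $s\in S$. A standard Borel space is a measurable space isomorphic to a Borel subset of a Polish space.
   Formalization: The "Moreover" part fails if V is identically zero on a set of positive measure; what is proved: Ṽ is a representation, exact once n is restricted to the (measurable) set where Ṽ(s) is not 0_T, and exact on all of (S,n) whenever V is exact. *)

theory Defs
  imports "HOL-Probability.Probability"
begin

text \<open>
  The index set \<open>T\<close> is the universe of a type \<open>'t\<close>. For \<open>I \<subseteq> T\<close> the space of real functions on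
  \<open>I\<close> is the product space \<open>cyl I\<close> of extensional functions, with its cylindrical
  \<open>\<sigma>\<close>-algebra. For uncountable \<open>T\<close>, \<open>cyl UNIV\<close> is strictly coarser than \<open>borel\<close> on \<open>'t \<Rightarrow> real\<close>.
\<close>

abbreviation cyl :: "'t set \<Rightarrow> ('t \<Rightarrow> real) measure" where
  "cyl I \<equiv> (\<Pi>\<^sub>M t\<in>I. borel)"

definition inner_measure :: "'a measure \<Rightarrow> 'a set \<Rightarrow> ennreal" where
  "inner_measure \<nu> E = (SUP D\<in>{D \<in> sets \<nu>. D \<subseteq> E}. emeasure \<nu> D)"

definition levy_measure :: "('t \<Rightarrow> real) measure \<Rightarrow> bool" where
  "levy_measure \<nu> \<longleftrightarrow>
     sets \<nu> = sets (cyl UNIV) \<and>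
     (\<forall>t. (\<integral>\<^sup>+x. ennreal (min (\<bar>x t\<bar>\<^sup>2) 1) \<partial>\<nu>) < \<infinity>) \<and>
     (\<forall>A\<in>sets \<nu>. emeasure \<nu> A = inner_measure \<nu> (A - {\<lambda>t. 0}))"

text \<open>
  A law on \<open>\<real>\<^sup>I\<close> is infinitely divisible if, for every \<open>m \<ge> 1\<close>, it is the law of a sum of \<open>m\<close>
  independent random vectors with a common law \<open>\<rho>\<close>.
\<close>

definition infinitely_divisible_law :: "'t set \<Rightarrow> ('t \<Rightarrow> real) measure \<Rightarrow> bool" where
  "infinitely_divisible_law I \<mu> \<longleftrightarrow>
     (\<forall>m::nat. m \<ge> 1 \<longrightarrow>
        (\<exists>\<rho>. prob_space \<rho> \<and> sets \<rho> = sets (cyl I) \<and>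
             \<mu> = distr (\<Pi>\<^sub>M k\<in>{..<m}. \<rho>) (cyl I) (\<lambda>y. \<lambda>t\<in>I. \<Sum>k<m. y k t)))"

definition infinitely_divisible_process :: "'w measure \<Rightarrow> ('t \<Rightarrow> 'w \<Rightarrow> real) \<Rightarrow> bool" where
  "infinitely_divisible_process P X \<longleftrightarrow>
     prob_space P \<and> (\<forall>t. X t \<in> borel_measurable P) \<and>
     (\<forall>I. finite I \<and> I \<noteq> {} \<longrightarrow>
        infinitely_divisible_law I (distr P (cyl I) (\<lambda>\<omega>. \<lambda>t\<in>I. X t \<omega>)))"

definition nonneg_definite :: "('t \<Rightarrow> 't \<Rightarrow> real) \<Rightarrow> bool" where
  "nonneg_definite \<Sigma> \<longleftrightarrow>
     (\<forall>s t. \<Sigma> s t = \<Sigma> t s) \<and>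
     (\<forall>I a. finite I \<longrightarrow> (\<Sum>s\<in>I. \<Sum>t\<in>I. a s * a t * \<Sigma> s t) \<ge> 0)"

text \<open>
  A vector \<open>a \<in> \<real>\<^sup>I\<close> is given by a function on all of \<open>'t\<close>, of which only the values on \<open>I\<close> are
  used. The integral against \<open>\<nu>\<close> always converges, by the integrability
  condition in \<open>levy_measure\<close>.
\<close>

definition levy_measure_of ::
  "'w measure \<Rightarrow> ('t \<Rightarrow> 'w \<Rightarrow> real) \<Rightarrow> ('t \<Rightarrow> real) measure \<Rightarrow> bool" where
  "levy_measure_of P X \<nu> \<longleftrightarrow>
     levy_measure \<nu> \<and>
     (\<exists>\<Sigma> b. nonneg_definite \<Sigma> \<and>
        (\<forall>I a. finite I \<and> I \<noteq> {} \<longrightarrow>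
           (\<integral>\<omega>. iexp (\<Sum>t\<in>I. a t * X t \<omega>) \<partial>P) =
           exp (- complex_of_real (1 / 2 * (\<Sum>s\<in>I. \<Sum>t\<in>I. a s * a t * \<Sigma> s t))
                + (\<integral>x. (iexp (\<Sum>t\<in>I. a t * x t) - 1
                        - \<i> * complex_of_real (\<Sum>t\<in>I. a t * x t * indicator {y. \<bar>y\<bar> \<le> 1} (x t))) \<partial>\<nu>)
                + \<i> * complex_of_real (\<Sum>t\<in>I. a t * b t))))"

definition levy_representation ::
  "'s measure \<Rightarrow> ('t \<Rightarrow> 's \<Rightarrow> real) \<Rightarrow> ('t \<Rightarrow> real) measure \<Rightarrow> bool" where
  "levy_representation n V \<nu> \<longleftrightarrow>
     (\<forall>t. V t \<in> borel_measurable n) \<and>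
     (\<forall>I B. finite I \<and> I \<noteq> {} \<and> B \<in> sets (cyl I) \<and> (\<lambda>t\<in>I. 0) \<notin> B \<longrightarrow>
        emeasure n {s \<in> space n. (\<lambda>t\<in>I. V t s) \<in> B} =
        emeasure \<nu> {x \<in> space \<nu>. restrict x I \<in> B})"

definition exact_levy_representation ::
  "'s measure \<Rightarrow> ('t \<Rightarrow> 's \<Rightarrow> real) \<Rightarrow> ('t \<Rightarrow> real) measure \<Rightarrow> bool" where
  "exact_levy_representation n V \<nu> \<longleftrightarrow>
     levy_representation n V \<nu> \<and> distr n (cyl UNIV) (\<lambda>s t. V t s) = \<nu>"

definition paths_in :: "'s measure \<Rightarrow> ('t \<Rightarrow> 's \<Rightarrow> real) \<Rightarrow> ('t \<Rightarrow> real) set \<Rightarrow> bool" where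
  "paths_in n V U \<longleftrightarrow> (\<forall>s\<in>space n. (\<lambda>t. V t s) \<in> U)"

text \<open>
  A representation is insensitive to an additional part of \<open>S\<close> on which all \<open>V t\<close> vanish, whereas
  an exact one may vanish identically only on a null set: on the two-point space \<open>{0, 1}\<close> with
  counting measure, \<open>V s = s\<close> (with a one-point index set) represents \<open>\<nu> = \<delta>\<^sub>1\<close>, but neither \<open>V\<close>
  nor a modification of it on a null set has the law \<open>\<nu>\<close>. Exactness of a modification of a general
  representation therefore refers to the part of \<open>S\<close> where its path is not the zero function.
\<close>

definition nonzero_set :: "'s measure \<Rightarrow> ('t \<Rightarrow> 's \<Rightarrow> real) \<Rightarrow> 's set" where
  "nonzero_set n V = {s \<in> space n. (\<lambda>t. V t s) \<noteq> (\<lambda>t. 0)}"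

definition additive_subgroup :: "('t \<Rightarrow> real) set \<Rightarrow> bool" where
  "additive_subgroup U \<longleftrightarrow>
     (\<lambda>t. 0) \<in> U \<and>
     (\<forall>x\<in>U. \<forall>y\<in>U. (\<lambda>t. x t + y t) \<in> U) \<and>
     (\<forall>x\<in>U. (\<lambda>t. - x t) \<in> U)"

text \<open>
  \<open>M\<close> is standard Borel, witnessed by an isomorphism with a Borel subset of the Polish space
  \<open>'p\<close>. Used as a hypothesis with a free type variable \<open>'p\<close>, this says that some such Polish
  space exists.
\<close>

definition standard_borel_via :: "'p::polish_space itself \<Rightarrow> 'a measure \<Rightarrow> bool" where
  "standard_borel_via _ M \<longleftrightarrow>
     (\<exists>B\<in>sets (borel :: 'p measure).
        \<exists>f\<in>measurable M (restrict_space borel B).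
        \<exists>g\<in>measurable (restrict_space borel B) M.
          (\<forall>x\<in>space M. g (f x) = x) \<and> (\<forall>y\<in>B. f (g y) = y))"

end

theory Submission
  imports Defs
begin

text \<open>
  The theorem rests on one fact: a measurable set \<open>D\<close> that misses the group \<open>U\<close> has measure \<open>\<nu> D = 0\<close>
  (lemma \<open>levy_measure_null_off_subgroup\<close>). Informally, \<open>\<nu>\<close> describes the jumps of \<open>X\<close>. If
  \<open>0 < \<nu> D < \<infinity>\<close> and \<open>\<xi>\<close> is an independent random path with law proportional to \<open>\<nu>\<close> on \<open>D\<close>, then
  the law of \<open>X + \<xi>\<close> is absolutely continuous with respect to that of \<open>X\<close>. As \<open>X\<close> stays in \<open>U\<close>, so does
  \<open>X + \<xi>\<close> up to modification, and therefore also \<open>\<xi>\<close>, because \<open>U\<close> is a group. But \<open>\<xi>\<close> is in \<open>D\<close>.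

  The absolute continuity (lemma \<open>convolve_levy_part_absolutely_continuous\<close>) is derived from the
  Levy-Khintchine formula. Let \<open>\<phi>\<close> be the Fourier transform of the law \<open>\<mu>\<close> of \<open>X\<close> and \<open>k\<close> that of the
  restriction \<open>\<rho>\<close> of \<open>\<nu>\<close> to \<open>D\<close>. Up to a positive constant \<open>\<phi>\<close> is \<open>exp k\<close> times the exponential of an exponent
  of the same type, with \<open>\<nu>\<close> restricted to the complement of \<open>D\<close>. Such an exponential is positive
  definite, and \<open>exp z * (1 - e * z + e\<^sup>2 / 2 * z\<^sup>2)\<close> has nonnegative Taylor coefficients for \<open>0 \<le> e \<le> 1\<close>,
  so \<open>\<phi> * (1 - e * k + e\<^sup>2 / 2 * k\<^sup>2)\<close> is positive definite (lemma \<open>levy_khintchine_pos_kernel\<close>). A signed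
  measure with positive definite Fourier transform is nonnegative, because trigonometric
  polynomials approximate indicator functions (lemma \<open>nonnegative_if_fourier_positive_definite\<close>).
  Thus \<open>e * (\<mu> * \<rho>) \<le> \<mu> + e\<^sup>2 / 2 * (\<mu> * \<rho> * \<rho>)\<close>, and on a \<open>\<mu>\<close>-null set division by \<open>e\<close> and \<open>e \<rightarrow> 0\<close> give
  \<open>\<mu> * \<rho> = 0\<close>.

  The set \<open>U\<close> itself need not be measurable in \<open>\<real>\<^sup>T\<close>. The standard Borel property enters through a
  measurable retraction \<open>h\<close> of \<open>\<real>\<^sup>T\<close> onto \<open>U\<close> (lemma \<open>standard_borel_retraction\<close>): measurable sets with
  the same trace on \<open>U\<close> have the same \<open>\<nu>\<close>-measure, so that the image of \<open>\<nu>\<close> under \<open>h\<close> is \<open>\<nu>\<close> on \<open>U\<close>, and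
  \<open>h \<circ> V\<close> is the required modification of a representation \<open>V\<close>. The sets \<open>{x. h x t \<noteq> x t}\<close> on which
  the two differ do not contain the zero function, and on such sets a representation has the same
  measure as \<open>\<nu>\<close> (lemma \<open>levy_representation_emeasure\<close>).
\<close>

section \<open>Trigonometric polynomials in finitely many coordinates\<close>

definition supp :: "('t \<Rightarrow> real) \<Rightarrow> 't set" where
  "supp a = {t. a t \<noteq> 0}"

text \<open>
  Frequencies are functions \<open>a\<close> on all of \<open>T\<close> with finite support. Summing over the support
  makes them independent of an auxiliary finite index set, so that they form a group under
  pointwise addition, which indexes positive definite functions below.
\<close>

definition pairing :: "('t \<Rightarrow> real) \<Rightarrow> ('t \<Rightarrow> real) \<Rightarrow> real" where
  "pairing a x = (\<Sum>t\<in>supp a. a t * x t)"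

lemma pairing_eq_sum:
  assumes "finite I" "supp a \<subseteq> I"
  shows "pairing a x = (\<Sum>t\<in>I. a t * x t)"
  unfolding pairing_def using assms by (intro sum.mono_neutral_left) (auto simp: supp_def)

lemma finite_supp_add:
  "finite (supp a) \<Longrightarrow> finite (supp b) \<Longrightarrow> finite (supp (\<lambda>t. a t + b t))"
  by (rule finite_subset[of _ "supp a \<union> supp b"]) (auto simp: supp_def)

lemma pairing_add:
  assumes "finite (supp a)" "finite (supp b)"
  shows "pairing (\<lambda>t. a t + b t) x = pairing a x + pairing b x"
proof -
  have f: "finite (supp a \<union> supp b)" using assms by auto
  show ?thesis
    by (subst (1 2 3) pairing_eq_sum[OF f]) (auto simp: supp_def sum.distrib algebra_simps)
qed

lemma pairing_diff:
  assumes "finite (supp a)" "finite (supp b)"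
  shows "pairing (\<lambda>t. a t - b t) x = pairing a x - pairing b x"
proof -
  have f: "finite (supp a \<union> supp b)" using assms by auto
  show ?thesis
    by (subst (1 2 3) pairing_eq_sum[OF f]) (auto simp: supp_def sum_subtractf algebra_simps)
qed

lemma pairing_plus_right: "pairing a (\<lambda>t. x t + y t) = pairing a x + pairing a y"
  by (simp add: pairing_def sum.distrib algebra_simps)

lemma measurable_pairing [measurable]: "pairing a \<in> borel_measurable (cyl UNIV)"
  unfolding pairing_def by measurable

inductive_set trig_poly :: "(('t \<Rightarrow> real) \<Rightarrow> complex) set" where
  monomial: "finite (supp a) \<Longrightarrow> (\<lambda>x. c * iexp (pairing a x)) \<in> trig_poly"
| add: "f \<in> trig_poly \<Longrightarrow> g \<in> trig_poly \<Longrightarrow> (\<lambda>x. f x + g x) \<in> trig_poly"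

lemma trig_poly_mult:
  assumes "f \<in> trig_poly" "g \<in> trig_poly"
  shows "(\<lambda>x. f x * g x) \<in> trig_poly"
  using assms(1)
proof induction
  case (monomial a c)
  show ?case using assms(2)
  proof induction
    case (monomial b d)
    have "(\<lambda>x. c * iexp (pairing a x) * (d * iexp (pairing b x)))
      = (\<lambda>x. (c * d) * iexp (pairing (\<lambda>t. a t + b t) x))"
      using \<open>finite (supp a)\<close> \<open>finite (supp b)\<close>
      by (auto simp: pairing_add distrib_left exp_add)
    then show ?case
      using finite_supp_add[OF \<open>finite (supp a)\<close> \<open>finite (supp b)\<close>]
      by (simp only: trig_poly.monomial)
  next
    case (add f g)
    then show ?case by (auto simp: distrib_left intro!: trig_poly.add)
  qed
next
  case (add f g)
  then show ?case by (auto simp: distrib_right intro!: trig_poly.add)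
qed

lemma trig_poly_const: "(\<lambda>x. c) \<in> trig_poly"
  using trig_poly.monomial[of "\<lambda>t. 0" c] by (simp add: supp_def pairing_def)

lemma trig_poly_bounded:
  assumes "f \<in> trig_poly" shows "\<exists>B. \<forall>x. norm (f x) \<le> B"
  using assms
proof induction
  case (monomial a c)
  show ?case by (rule exI[of _ "norm c"]) (simp add: norm_mult)
next
  case (add f g)
  then obtain B C where "\<forall>x. norm (f x) \<le> B" "\<forall>x. norm (g x) \<le> C" by blast
  then have "\<forall>x. norm (f x + g x) \<le> B + C" by (meson norm_triangle_mono)
  then show ?case ..
qed

lemma trig_poly_measurable: "f \<in> trig_poly \<Longrightarrow> f \<in> borel_measurable (cyl UNIV)"
proof (induction rule: trig_poly.induct)
  case (monomial a c)
  show ?case by measurable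
next
  case (add f g)
  then show ?case by simp
qed

lemma trig_poly_expansion:
  assumes "f \<in> trig_poly"
  obtains J c where "finite J" "\<And>a. a \<in> J \<Longrightarrow> finite (supp a)"
    "f = (\<lambda>x. \<Sum>a\<in>J. c a * iexp (pairing a x))"
proof -
  have "\<exists>J c. finite J \<and> (\<forall>a\<in>J. finite (supp a)) \<and> f = (\<lambda>x. \<Sum>a\<in>J. c a * iexp (pairing a x))"
    using assms
  proof induction
    case (monomial a c)
    then show ?case by (intro exI[of _ "{a}"] exI[of _ "\<lambda>_. c"]) auto
  next
    case (add f g)
    obtain J c where 1: "finite J" "\<forall>a\<in>J. finite (supp a)"
      "f = (\<lambda>x. \<Sum>a\<in>J. c a * iexp (pairing a x))" using add.IH(1) by blast
    obtain K d where 2: "finite K" "\<forall>a\<in>K. finite (supp a)"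
      "g = (\<lambda>x. \<Sum>a\<in>K. d a * iexp (pairing a x))" using add.IH(2) by blast
    let ?e = "\<lambda>a. (if a \<in> J then c a else 0) + (if a \<in> K then d a else 0)"
    have "f x + g x = (\<Sum>a\<in>J \<union> K. ?e a * iexp (pairing a x))" for x
    proof -
      have "f x = (\<Sum>a\<in>J \<union> K. (if a \<in> J then c a else 0) * iexp (pairing a x))"
        unfolding 1(3) using 1 2 by (intro sum.mono_neutral_cong_left) auto
      moreover have "g x = (\<Sum>a\<in>J \<union> K. (if a \<in> K then d a else 0) * iexp (pairing a x))"
        unfolding 2(3) using 1 2 by (intro sum.mono_neutral_cong_left) auto
      ultimately show ?thesis by (simp add: sum.distrib distrib_right)
    qed
    then show ?case using 1 2 by (intro exI[of _ "J \<union> K"] exI[of _ ?e]) auto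
  qed
  then show ?thesis using that by blast
qed

definition real_trig :: "(('t \<Rightarrow> real) \<Rightarrow> real) \<Rightarrow> bool" where
  "real_trig p \<longleftrightarrow> (\<lambda>x. complex_of_real (p x)) \<in> trig_poly"

lemma real_trig_const: "real_trig (\<lambda>x. r)"
  unfolding real_trig_def by (rule trig_poly_const)

lemma real_trig_add: "real_trig p \<Longrightarrow> real_trig q \<Longrightarrow> real_trig (\<lambda>x. p x + q x)"
  unfolding real_trig_def using trig_poly.add by fastforce

lemma real_trig_mult: "real_trig p \<Longrightarrow> real_trig q \<Longrightarrow> real_trig (\<lambda>x. p x * q x)"
  unfolding real_trig_def using trig_poly_mult by fastforce

lemma real_trig_bounded:
  assumes "real_trig p" obtains B where "\<And>x. \<bar>p x\<bar> \<le> B"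
  using trig_poly_bounded[OF assms[unfolded real_trig_def]] by auto

lemma real_trig_measurable:
  assumes "real_trig p" shows "p \<in> borel_measurable (cyl UNIV)"
proof -
  have "(\<lambda>x. Re (complex_of_real (p x))) \<in> borel_measurable (cyl UNIV)"
    using trig_poly_measurable[OF assms[unfolded real_trig_def]] by measurable
  then show ?thesis by simp
qed

lemma real_trig_sin: "real_trig (\<lambda>x. sin (r * x t))"
proof -
  define a where "a = (\<lambda>s. if s = t then r else 0)"
  have s: "supp a \<subseteq> {t}" "supp (\<lambda>s. - a s) \<subseteq> {t}" by (auto simp: supp_def a_def)
  then have fin: "finite (supp a)" "finite (supp (\<lambda>s. - a s))" using finite_subset by blast+
  have p: "pairing a x = r * x t" "pairing (\<lambda>s. - a s) x = - (r * x t)" for x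
    using pairing_eq_sum[OF _ s(1)] pairing_eq_sum[OF _ s(2)] by (auto simp: a_def)
  have "complex_of_real (sin (r * x t))
      = (-\<i>/2) * iexp (pairing a x) + (\<i>/2) * iexp (pairing (\<lambda>s. - a s) x)" for x
    unfolding p sin_of_real[symmetric] sin_exp_eq
    by (simp add: divide_simps) (simp add: algebra_simps)
  then show ?thesis
    unfolding real_trig_def by (simp only:) (intro trig_poly.intros fin)
qed

lemma real_trig_polynomial:
  assumes "real_polynomial_function q" "real_trig p"
  shows "real_trig (\<lambda>x. q (p x))"
  using assms(1)
proof induction
  case (linear f)
  then obtain c where "f = (\<lambda>x. x * c)" using real_bounded_linear by blast
  then show ?case using real_trig_mult[OF assms(2) real_trig_const] by simp
qed (auto intro: real_trig_const real_trig_add real_trig_mult)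

text \<open>
  The uniform closure of the real trigonometric polynomials. In contrast to the polynomials
  themselves it is closed under continuous functions, hence a lattice, which is what the
  approximation of indicator functions uses.
\<close>

definition uniform_trig :: "(('t \<Rightarrow> real) \<Rightarrow> real) \<Rightarrow> bool" where
  "uniform_trig f \<longleftrightarrow> (\<forall>e>0. \<exists>p. real_trig p \<and> (\<forall>x. \<bar>f x - p x\<bar> < e))"

lemma real_trig_uniform: "real_trig p \<Longrightarrow> uniform_trig p"
  unfolding uniform_trig_def by force

lemma uniform_trig_bounded:
  assumes "uniform_trig f" obtains B where "\<And>x. \<bar>f x\<bar> \<le> B"
proof -
  obtain p where p: "real_trig p" "\<forall>x. \<bar>f x - p x\<bar> < 1"
    using assms unfolding uniform_trig_def by (meson zero_less_one)
  obtain B where "\<And>x. \<bar>p x\<bar> \<le> B" using real_trig_bounded[OF p(1)] by blast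
  then have "\<bar>f x\<bar> \<le> B + 1" for x
    using p(2)[rule_format, of x] \<open>\<And>x. \<bar>p x\<bar> \<le> B\<close>[of x] by linarith
  then show ?thesis using that by blast
qed

lemma uniform_trig_add:
  assumes "uniform_trig f" "uniform_trig g" shows "uniform_trig (\<lambda>x. f x + g x)"
  unfolding uniform_trig_def
proof (intro allI impI)
  fix e :: real assume "e > 0"
  then have e: "e / 2 > 0" by simp
  obtain p where p: "real_trig p" "\<forall>x. \<bar>f x - p x\<bar> < e / 2"
    using assms(1) e unfolding uniform_trig_def by blast
  obtain q where q: "real_trig q" "\<forall>x. \<bar>g x - q x\<bar> < e / 2"
    using assms(2) e unfolding uniform_trig_def by blast
  have "\<bar>f x + g x - (p x + q x)\<bar> < e" for x
    using p(2)[rule_format, of x] q(2)[rule_format, of x] by linarith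
  then show "\<exists>p. real_trig p \<and> (\<forall>x. \<bar>f x + g x - p x\<bar> < e)"
    using real_trig_add[OF p(1) q(1)] by blast
qed

text \<open>
  A function in the uniform closure is bounded, so that only the restriction of \<open>G\<close> to a compact
  interval matters; there \<open>G\<close> is a uniform limit of polynomials by the Weierstrass theorem, and a
  polynomial in a trigonometric polynomial is a trigonometric polynomial.
\<close>

lemma uniform_trig_compose:
  assumes f: "uniform_trig f" and G: "continuous_on UNIV (G :: real \<Rightarrow> real)"
  shows "uniform_trig (\<lambda>x. G (f x))"
  unfolding uniform_trig_def
proof (intro allI impI)
  fix e :: real assume e: "e > 0"
  obtain B where B: "\<And>x. \<bar>f x\<bar> \<le> B" using uniform_trig_bounded[OF f] by blast
  let ?K = "{- (B + 1)..B + 1}"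
  have "uniformly_continuous_on ?K G"
    by (intro compact_uniformly_continuous continuous_on_subset[OF G]) auto
  then obtain d where d: "d > 0" "\<And>x y. x \<in> ?K \<Longrightarrow> y \<in> ?K \<Longrightarrow> dist y x < d \<Longrightarrow> dist (G y) (G x) < e / 2"
    unfolding uniformly_continuous_on_def using e by (meson half_gt_zero)
  obtain p where p: "real_trig p" "\<forall>x. \<bar>f x - p x\<bar> < min d 1"
    using f d(1) unfolding uniform_trig_def by (metis min_less_iff_conj zero_less_one)
  obtain q where q: "real_polynomial_function q" "\<And>y. y \<in> ?K \<Longrightarrow> \<bar>G y - q y\<bar> < e / 2"
    using Stone_Weierstrass_real_polynomial_function[of ?K G "e / 2"] e continuous_on_subset[OF G]
    by (metis compact_Icc half_gt_zero subset_UNIV)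
  have "\<bar>G (f x) - q (p x)\<bar> < e" for x
  proof -
    have "\<bar>f x\<bar> \<le> B" "\<bar>f x - p x\<bar> < d" "\<bar>f x - p x\<bar> < 1"
      using B p(2)[rule_format, of x] by auto
    then have "f x \<in> ?K" "p x \<in> ?K" "dist (f x) (p x) < d" by (auto simp: dist_real_def)
    then have "\<bar>G (f x) - G (p x)\<bar> < e / 2" "\<bar>G (p x) - q (p x)\<bar> < e / 2"
      using d(2) q(2) by (auto simp: dist_real_def)
    then show ?thesis by linarith
  qed
  then show "\<exists>p. real_trig p \<and> (\<forall>x. \<bar>G (f x) - p x\<bar> < e)"
    using real_trig_polynomial[OF q(1) p(1)] by blast
qed

lemma uniform_trig_scale:
  fixes c :: real
  assumes "uniform_trig f" shows "uniform_trig (\<lambda>x. c * f x)"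
proof -
  have c: "continuous_on UNIV (\<lambda>y::real. c * y)" by (intro continuous_on_mult_left continuous_on_id)
  show ?thesis by (rule uniform_trig_compose[OF assms c])
qed

lemma uniform_trig_max_min:
  assumes "uniform_trig f" "uniform_trig g"
  shows "uniform_trig (\<lambda>x. max (f x) (g x))" "uniform_trig (\<lambda>x. min (f x) (g x))"
proof -
  have sub: "uniform_trig (\<lambda>x. f x + (-1) * g x)"
    by (rule uniform_trig_add[OF assms(1) uniform_trig_scale[OF assms(2)]])
  have c: "continuous_on UNIV (\<lambda>y::real. \<bar>y\<bar>)" by (rule continuous_on_rabs[OF continuous_on_id])
  have abs: "uniform_trig (\<lambda>x. \<bar>f x + (-1) * g x\<bar>)"
    by (rule uniform_trig_compose[OF sub c])
  have max: "max (f x) (g x) = (1/2) * ((f x + g x) + \<bar>f x + (-1) * g x\<bar>)"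
    and min: "min (f x) (g x) = (1/2) * ((f x + g x) + (-1) * \<bar>f x + (-1) * g x\<bar>)" for x
    by auto
  show "uniform_trig (\<lambda>x. max (f x) (g x))"
    unfolding max by (rule uniform_trig_scale[OF uniform_trig_add[OF uniform_trig_add[OF assms] abs]])
  show "uniform_trig (\<lambda>x. min (f x) (g x))"
    unfolding min
    by (rule uniform_trig_scale[OF uniform_trig_add[OF uniform_trig_add[OF assms] uniform_trig_scale[OF abs]]])
qed

lemma uniform_trig_measurable:
  assumes "uniform_trig f" shows "f \<in> borel_measurable (cyl UNIV)"
proof -
  have "\<forall>n. \<exists>p. real_trig p \<and> (\<forall>x. \<bar>f x - p x\<bar> < 1 / real (Suc n))"
    using assms unfolding uniform_trig_def by simp
  then obtain p where p: "\<And>n. real_trig (p n)" "\<And>n x. \<bar>f x - p n x\<bar> < 1 / real (Suc n)" by metis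
  have lim: "(\<lambda>n. p n x) \<longlonglongrightarrow> f x" for x
  proof (rule LIMSEQ_I)
    fix r :: real assume "r > 0"
    then obtain N where N: "1 / real (Suc N) < r" using nat_approx_posE by blast
    have "norm (p n x - f x) < r" if "n \<ge> N" for n
    proof -
      have "1 / real (Suc n) \<le> 1 / real (Suc N)" using that by (simp add: frac_le)
      then show ?thesis using p(2)[of x n] N by (simp add: abs_minus_commute)
    qed
    then show "\<exists>N. \<forall>n\<ge>N. norm (p n x - f x) < r" by blast
  qed
  show ?thesis
    by (rule borel_measurable_LIMSEQ_real[OF lim real_trig_measurable[OF p(1)]])
qed

section \<open>Approximation of indicator functions\<close>

lemma space_cyl: "space (cyl UNIV) = UNIV"
  by (simp add: space_PiM)

text \<open>
  A coordinate is not a bounded function, but it is the pointwise limit of \<open>n * sin (x t / n)\<close>.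
\<close>

lemma uniform_trig_sets_generate:
  "sets (cyl UNIV) = sigma_sets UNIV {{x. 0 < f x} | f. uniform_trig f}" (is "_ = sigma_sets _ ?E")
proof (rule antisym)
  have "?E \<subseteq> sets (cyl UNIV)"
  proof safe
    fix f :: "('a \<Rightarrow> real) \<Rightarrow> real" assume "uniform_trig f"
    then have [measurable]: "f \<in> borel_measurable (cyl UNIV)" by (rule uniform_trig_measurable)
    have "{x \<in> space (cyl UNIV). 0 < f x} \<in> sets (cyl UNIV)" by measurable
    then show "{x. 0 < f x} \<in> sets (cyl UNIV)" by (simp add: space_cyl)
  qed
  then show "sigma_sets UNIV ?E \<subseteq> sets (cyl UNIV)"
    using sets.sigma_sets_subset[of ?E "cyl UNIV"] unfolding space_cyl by blast
next
  let ?S = "sigma UNIV ?E"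
  have sets_S: "sets ?S = sigma_sets UNIV ?E" by (rule sets_measure_of) auto
  have meas: "f \<in> borel_measurable ?S" if "uniform_trig f" for f
  proof (subst borel_measurable_iff_greater, rule allI)
    fix r :: real
    have "uniform_trig (\<lambda>x. f x + (- r))"
      by (rule uniform_trig_add[OF that real_trig_uniform[OF real_trig_const]])
    then have "{x. 0 < f x + (- r)} \<in> sigma_sets UNIV ?E"
      by (intro sigma_sets.Basic CollectI exI[of _ "\<lambda>x. f x + (- r)"] conjI refl)
    also have "{x. 0 < f x + (- r)} = {w \<in> space ?S. r < f w}" by auto
    finally show "{w \<in> space ?S. r < f w} \<in> sets ?S" unfolding sets_S .
  qed
  have coord: "(\<lambda>x. x t) \<in> borel_measurable ?S" for t :: 'a
  proof (rule borel_measurable_LIMSEQ_real[where u = "\<lambda>n x. real n * sin (inverse (real n) * x t)"])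
    fix n
    have "(\<lambda>x. sin (inverse (real n) * x t)) \<in> borel_measurable ?S"
      by (rule meas[OF real_trig_uniform[OF real_trig_sin]])
    then show "(\<lambda>x. real n * sin (inverse (real n) * x t)) \<in> borel_measurable ?S" by measurable
  next
    fix x :: "'a \<Rightarrow> real"
    have "(\<lambda>n. real n * sin (inverse (real n) * c)) \<longlonglongrightarrow> c" for c
    proof -
      consider "c = 0" | "c > 0" | "c < 0" by linarith
      then show ?thesis by cases (simp, real_asymp+)
    qed
    then show "(\<lambda>n. real n * sin (inverse (real n) * x t)) \<longlonglongrightarrow> x t" .
  qed
  have id: "(\<lambda>x. x) \<in> measurable ?S (cyl UNIV)"
    using measurable_PiM_single'[of UNIV "\<lambda>t x. x t" ?S "\<lambda>_. borel"] coord by (simp add: space_PiM)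
  show "sets (cyl UNIV) \<subseteq> sigma_sets UNIV ?E"
  proof
    fix A :: "('a \<Rightarrow> real) set" assume "A \<in> sets (cyl UNIV)"
    from measurable_sets[OF id this] show "A \<in> sigma_sets UNIV ?E"
      unfolding sets_S by simp
  qed
qed

text \<open>
  The sets whose indicator can be approximated simultaneously in all the spaces \<open>L\<^sup>1(\<mu> i)\<close> form a
  Dynkin system. It contains the sets \<open>{f > 0}\<close> with \<open>f\<close> in the uniform closure; these are
  stable under intersection because \<open>{f > 0} \<inter> {g > 0} = {min f g > 0}\<close>, and they generate the
  cylindrical \<open>\<sigma>\<close>-algebra. Keeping the approximants between 0 and 1 later allows to replace them by
  their squares.
\<close>

lemma indicator_approximation:
  fixes \<mu> :: "'i \<Rightarrow> ('t \<Rightarrow> real) measure"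
  assumes F: "finite F" and fin: "\<And>i. i \<in> F \<Longrightarrow> finite_measure (\<mu> i)"
    and sets_\<mu>: "\<And>i. i \<in> F \<Longrightarrow> sets (\<mu> i) = sets (cyl UNIV)"
    and A: "A \<in> sets (cyl UNIV)" and e: "e > 0"
  shows "\<exists>f. uniform_trig f \<and> (\<forall>x. 0 \<le> f x \<and> f x \<le> 1)
    \<and> (\<forall>i\<in>F. (\<integral>x. \<bar>indicator A x - f x\<bar> \<partial>\<mu> i) < e)"
proof -
  let ?E = "{{x. 0 < f x} | f. uniform_trig f} :: ('t \<Rightarrow> real) set set"
  define good where "good f \<longleftrightarrow> uniform_trig f \<and> (\<forall>x. 0 \<le> f x \<and> f x \<le> 1)" for f :: "('t \<Rightarrow> real) \<Rightarrow> real"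
  define approx where "approx A \<longleftrightarrow> (\<forall>e>0. \<exists>f. good f \<and> (\<forall>i\<in>F. (\<integral>x. \<bar>indicator A x - f x\<bar> \<partial>\<mu> i) < e))" for A
  have int: "integrable (\<mu> i) f" if "i \<in> F" "f \<in> borel_measurable (cyl UNIV)" "\<And>x. \<bar>f x\<bar> \<le> 1"
    for i and f :: "_ \<Rightarrow> real"
  proof -
    interpret finite_measure "\<mu> i" by (rule fin) fact
    show ?thesis using that measurable_cong_sets[OF sets_\<mu>[OF that(1)] refl]
      by (intro integrable_const_bound[of _ 1]) auto
  qed
  have good_meas: "f \<in> borel_measurable (cyl UNIV)" if "good f" for f
    using that uniform_trig_measurable unfolding good_def by blast
  have good_bd: "\<bar>indicator A x - f x\<bar> \<le> 1" if "good f" for f x and A :: "('t \<Rightarrow> real) set"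
    using that unfolding good_def by (auto simp: indicator_def)
  have int_diff: "integrable (\<mu> i) (\<lambda>x. \<bar>indicator A x - f x\<bar>)"
    if "i \<in> F" "good f" "A \<in> sets (cyl UNIV)" for i f A
    using that good_meas[OF that(2)] good_bd[OF that(2)] by (intro int) auto
  have approxD: "\<exists>f. good f \<and> (\<forall>i\<in>F. (\<integral>x. \<bar>indicator A x - f x\<bar> \<partial>\<mu> i) < e)" if "approx A" "e > 0" for A e
    using that unfolding approx_def by blast
  have good_max: "good (\<lambda>x. max (f x) (g x))" if "good f" "good g" for f g
    using that uniform_trig_max_min(1) unfolding good_def by (auto simp: le_max_iff_disj)

  have approx_Un: "approx (A \<union> B)" if AB: "approx A" "approx B" "A \<in> sets (cyl UNIV)" "B \<in> sets (cyl UNIV)" for A B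
    unfolding approx_def
  proof (intro allI impI)
    fix e :: real assume "e > 0"
    then have e2: "e / 2 > 0" by simp
    obtain f where f: "good f" "\<forall>i\<in>F. (\<integral>x. \<bar>indicator A x - f x\<bar> \<partial>\<mu> i) < e / 2"
      using approxD[OF AB(1) e2] by blast
    obtain g where g: "good g" "\<forall>i\<in>F. (\<integral>x. \<bar>indicator B x - g x\<bar> \<partial>\<mu> i) < e / 2"
      using approxD[OF AB(2) e2] by blast
    have "(\<integral>x. \<bar>indicator (A \<union> B) x - max (f x) (g x)\<bar> \<partial>\<mu> i) < e" if i: "i \<in> F" for i
    proof -
      have "(\<integral>x. \<bar>indicator (A \<union> B) x - max (f x) (g x)\<bar> \<partial>\<mu> i)
          \<le> (\<integral>x. \<bar>indicator A x - f x\<bar> + \<bar>indicator B x - g x\<bar> \<partial>\<mu> i)"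
      proof (rule integral_mono)
        show "integrable (\<mu> i) (\<lambda>x. \<bar>indicator (A \<union> B) x - max (f x) (g x)\<bar>)"
          using int_diff[OF i good_max[OF f(1) g(1)], of "A \<union> B"] AB by auto
        show "integrable (\<mu> i) (\<lambda>x. \<bar>indicator A x - f x\<bar> + \<bar>indicator B x - g x\<bar>)"
          using int_diff[OF i f(1)] int_diff[OF i g(1)] AB by auto
        show "\<bar>indicator (A \<union> B) x - max (f x) (g x)\<bar> \<le> \<bar>indicator A x - f x\<bar> + \<bar>indicator B x - g x\<bar>" for x
          using f(1) g(1) unfolding good_def by (auto simp: indicator_def max_def) (smt (verit))+
      qed
      also have "\<dots> = (\<integral>x. \<bar>indicator A x - f x\<bar> \<partial>\<mu> i) + (\<integral>x. \<bar>indicator B x - g x\<bar> \<partial>\<mu> i)"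
        using int_diff[OF i f(1)] int_diff[OF i g(1)] AB by (intro Bochner_Integration.integral_add) auto
      also have "\<dots> < e" using f(2) g(2) i by force
      finally show ?thesis .
    qed
    then show "\<exists>h. good h \<and> (\<forall>i\<in>F. (\<integral>x. \<bar>indicator (A \<union> B) x - h x\<bar> \<partial>\<mu> i) < e)"
      using good_max[OF f(1) g(1)] by blast
  qed
  have good_const: "good (\<lambda>x. 0)"
    unfolding good_def by (auto intro: real_trig_uniform real_trig_const)
  have approx_empty: "approx {}"
    unfolding approx_def using good_const by (auto intro!: exI[of _ "\<lambda>x. 0"])
  have Int: "Int_stable ?E"
  proof (rule Int_stableI)
    fix A B assume "A \<in> ?E" "B \<in> ?E"
    then obtain f g where fg: "A = {x. 0 < f x}" "B = {x. 0 < g x}" "uniform_trig f" "uniform_trig g" by blast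
    have "A \<inter> B = {x. 0 < min (f x) (g x)}" unfolding fg by auto
    then show "A \<inter> B \<in> ?E"
      by (intro CollectI exI[of _ "\<lambda>x. min (f x) (g x)"] conjI uniform_trig_max_min(2)[OF fg(3,4)])
  qed
  have cyl_sets: "sigma_sets UNIV ?E = sets (cyl UNIV)"
    by (rule uniform_trig_sets_generate[symmetric])
  have subset_Pow: "?E \<subseteq> Pow UNIV" by simp
  have "A \<in> sigma_sets UNIV ?E" using A unfolding cyl_sets .
  with Int subset_Pow have "approx A"
  proof (induction rule: sigma_sets_induct_disjoint)
    case (basic A)
    then obtain f where f: "A = {x. 0 < f x}" "uniform_trig f" by blast
    \<comment> \<open>ramps that increase to the indicator of \<open>{f > 0}\<close>\<close>
    define g where "g n x = min 1 (max 0 (real n * f x))" for n x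
    have g: "good (g n)" for n
    proof -
      have "uniform_trig (\<lambda>x. min 1 (max 0 (real n * f x)))"
        by (rule uniform_trig_compose[OF f(2), of "\<lambda>y. min 1 (max 0 (real n * y))"])
           (intro continuous_intros)
      then show ?thesis unfolding good_def g_def[abs_def] by auto
    qed
    have A_meas: "A \<in> sets (cyl UNIV)" using basic unfolding cyl_sets[symmetric] by (intro sigma_sets.Basic)
    have lim: "(\<lambda>n. g n x) \<longlonglongrightarrow> indicator A x" for x
    proof (cases "f x > 0")
      case True
      obtain N where N: "1 / f x < real N" using reals_Archimedean2 by blast
      have "g n x = 1" if "n \<ge> N" for n
      proof -
        have "1 / f x < real n" using N that by linarith
        then have "1 < real n * f x" using True by (simp add: field_simps)
        then show ?thesis by (simp add: g_def)
      qed
      then have "eventually (\<lambda>n. g n x = 1) sequentially" using eventually_sequentially by blast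
      then show ?thesis using True by (simp add: f tendsto_eventually)
    next
      case False
      then have "real n * f x \<le> 0" for n by (simp add: mult_nonneg_nonpos)
      then have "g n x = 0" for n by (simp add: g_def)
      then show ?thesis using False by (simp add: f)
    qed
    have "(\<lambda>n. \<integral>x. \<bar>indicator A x - g n x\<bar> \<partial>\<mu> i) \<longlonglongrightarrow> (\<integral>x. 0 \<partial>\<mu> i)" if i: "i \<in> F" for i
    proof (rule integral_dominated_convergence[where w = "\<lambda>_. 1"])
      show "integrable (\<mu> i) (\<lambda>_. 1::real)" by (rule int[OF i]) auto
      show "(\<lambda>x. \<bar>indicator A x - g n x\<bar>) \<in> borel_measurable (\<mu> i)" for n
        using int_diff[OF i g A_meas] by (rule borel_measurable_integrable)
      have "(\<lambda>n. \<bar>indicator A x - g n x\<bar>) \<longlonglongrightarrow> 0" for x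
        using tendsto_rabs[OF tendsto_diff[OF tendsto_const[of "indicator A x"] lim[of x]]] by simp
      then show "AE x in \<mu> i. (\<lambda>n. \<bar>indicator A x - g n x\<bar>) \<longlonglongrightarrow> 0" by simp
      show "AE x in \<mu> i. norm \<bar>indicator A x - g n x\<bar> \<le> 1" for n
        using good_bd[OF g, of A] by simp
    qed simp
    then have lim0: "(\<lambda>n. \<integral>x. \<bar>indicator A x - g n x\<bar> \<partial>\<mu> i) \<longlonglongrightarrow> 0" if "i \<in> F" for i
      using that by simp
    show "approx A" unfolding approx_def
    proof (intro allI impI)
      fix e :: real assume "e > 0"
      then have "eventually (\<lambda>n. \<forall>i\<in>F. (\<integral>x. \<bar>indicator A x - g n x\<bar> \<partial>\<mu> i) < e) sequentially"
        using lim0 by (intro eventually_ball_finite F ballI order_tendstoD(2)[of _ 0]) auto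
      then obtain n where "\<forall>i\<in>F. (\<integral>x. \<bar>indicator A x - g n x\<bar> \<partial>\<mu> i) < e"
        unfolding eventually_sequentially by blast
      then show "\<exists>f. good f \<and> (\<forall>i\<in>F. (\<integral>x. \<bar>indicator A x - f x\<bar> \<partial>\<mu> i) < e)" using g by blast
    qed
  next
    case empty show ?case by (rule approx_empty)
  next
    case (compl A)
    show ?case unfolding approx_def
    proof (intro allI impI)
      fix e :: real assume "e > 0"
      then obtain f where f: "good f" "\<forall>i\<in>F. (\<integral>x. \<bar>indicator A x - f x\<bar> \<partial>\<mu> i) < e"
        using approxD[OF compl(2)] by blast
      have "uniform_trig (\<lambda>x. 1 - f x)"
        using f(1) unfolding good_def
        by (intro uniform_trig_compose[of f "\<lambda>y. 1 - y"]) (auto intro!: continuous_intros)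
      then have "good (\<lambda>x. 1 - f x)" using f(1) unfolding good_def by auto
      moreover have "\<bar>indicator (UNIV - A) x - (1 - f x)\<bar> = \<bar>indicator A x - f x\<bar>" for x
        by (auto simp: indicator_def)
      ultimately show "\<exists>f. good f \<and> (\<forall>i\<in>F. (\<integral>x. \<bar>indicator (UNIV - A) x - f x\<bar> \<partial>\<mu> i) < e)"
        using f(2) by (intro exI[of _ "\<lambda>x. 1 - f x"]) simp
    qed
  next
    case (union A)
    have A_meas: "A i \<in> sets (cyl UNIV)" for i using union(2) unfolding cyl_sets by blast
    let ?B = "\<lambda>n. \<Union>k<n. A k"
    let ?A = "\<Union>k. A k"
    have B_meas: "?B n \<in> sets (cyl UNIV)" for n using A_meas by auto
    have B: "approx (?B n)" for n
    proof (induction n)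
      case 0 then show ?case using approx_empty by simp
    next
      case (Suc n)
      have "?B (Suc n) = A n \<union> ?B n" by (auto simp: less_Suc_eq)
      then show ?case using approx_Un[OF union(3) Suc A_meas B_meas] by simp
    qed
    have lim: "(\<lambda>n. measure (\<mu> i) (?A - ?B n)) \<longlonglongrightarrow> 0" if i: "i \<in> F" for i
    proof -
      interpret finite_measure "\<mu> i" by (rule fin) fact
      have "(\<lambda>n. measure (\<mu> i) (?A - ?B n)) \<longlonglongrightarrow> measure (\<mu> i) (\<Inter>n. ?A - ?B n)"
      proof (rule finite_Lim_measure_decseq)
        show "range (\<lambda>n. ?A - ?B n) \<subseteq> sets (\<mu> i)"
          unfolding sets_\<mu>[OF i] using A_meas B_meas by blast
        have "?B m \<subseteq> ?B n" if "m \<le> n" for m n using that by (intro UN_mono) auto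
        then show "decseq (\<lambda>n. ?A - ?B n)" unfolding decseq_def by blast
      qed
      also have "(\<Inter>n. ?A - ?B n) = {}" by auto
      finally show ?thesis by simp
    qed
    show ?case unfolding approx_def
    proof (intro allI impI)
      fix e :: real assume "e > 0"
      then have e2: "e / 2 > 0" by simp
      have "eventually (\<lambda>n. \<forall>i\<in>F. measure (\<mu> i) (?A - ?B n) < e / 2) sequentially"
        using lim e2 by (intro eventually_ball_finite F ballI order_tendstoD(2)[of _ 0]) auto
      then obtain n where n: "\<forall>i\<in>F. measure (\<mu> i) (?A - ?B n) < e / 2"
        unfolding eventually_sequentially by blast
      obtain f where f: "good f" "\<forall>i\<in>F. (\<integral>x. \<bar>indicator (?B n) x - f x\<bar> \<partial>\<mu> i) < e / 2"
        using approxD[OF B e2] by blast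
      have "(\<integral>x. \<bar>indicator ?A x - f x\<bar> \<partial>\<mu> i) < e" if i: "i \<in> F" for i
      proof -
        have m: "?A - ?B n \<in> sets (cyl UNIV)" using A_meas by auto
        have i1: "integrable (\<mu> i) (indicator (?A - ?B n) :: _ \<Rightarrow> real)"
          using m by (intro int[OF i]) (auto simp: indicator_def)
        have "(\<integral>x. \<bar>indicator ?A x - f x\<bar> \<partial>\<mu> i)
            \<le> (\<integral>x. \<bar>indicator (?B n) x - f x\<bar> + indicator (?A - ?B n) x \<partial>\<mu> i)"
        proof (rule integral_mono)
          show "integrable (\<mu> i) (\<lambda>x. \<bar>indicator ?A x - f x\<bar>)"
            using A_meas by (intro int_diff i f) auto
          show "integrable (\<mu> i) (\<lambda>x. \<bar>indicator (?B n) x - f x\<bar> + indicator (?A - ?B n) x)"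
            by (intro Bochner_Integration.integrable_add int_diff i f i1 B_meas)
          show "\<bar>indicator ?A x - f x\<bar> \<le> \<bar>indicator (?B n) x - f x\<bar> + indicator (?A - ?B n) x" for x
            using f(1) unfolding good_def by (auto simp: indicator_def)
        qed
        also have "\<dots> = (\<integral>x. \<bar>indicator (?B n) x - f x\<bar> \<partial>\<mu> i) + measure (\<mu> i) (?A - ?B n)"
          using m sets_\<mu>[OF i] sets.sets_into_space[of "?A - ?B n" "\<mu> i"]
          by (subst Bochner_Integration.integral_add[OF int_diff[OF i f(1) B_meas] i1])
             (simp add: Int_absorb2 del: UN_simps)
        also have "\<dots> < e" using n f(2) i by force
        finally show ?thesis .
      qed
      then show "\<exists>f. good f \<and> (\<forall>i\<in>F. (\<integral>x. \<bar>indicator ?A x - f x\<bar> \<partial>\<mu> i) < e)"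
        using f(1) by blast
    qed
  qed
  then show ?thesis using e unfolding approx_def good_def by blast
qed

section \<open>Positive definite kernels and Schur multipliers\<close>

definition pos_kernel :: "'j set \<Rightarrow> ('j \<Rightarrow> 'j \<Rightarrow> complex) \<Rightarrow> bool" where
  "pos_kernel J K \<longleftrightarrow> (\<forall>c. 0 \<le> Re (\<Sum>j\<in>J. \<Sum>k\<in>J. c j * cnj (c k) * K j k))"

text \<open>
  The kernels whose entrywise product with every positive definite kernel is again positive definite.
  By this definition they are closed under products as well as under sums and limits. The kernels
  below arise by these operations from sums and integrals of kernels of rank one.
\<close>

definition schur_multiplier :: "'j set \<Rightarrow> ('j \<Rightarrow> 'j \<Rightarrow> complex) \<Rightarrow> bool" where
  "schur_multiplier J M \<longleftrightarrow> (\<forall>K. pos_kernel J K \<longrightarrow> pos_kernel J (\<lambda>j k. K j k * M j k))"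

lemma pos_kernel_one: "pos_kernel J (\<lambda>j k. 1)"
  unfolding pos_kernel_def
proof
  fix c :: "'a \<Rightarrow> complex"
  have "(\<Sum>j\<in>J. \<Sum>k\<in>J. c j * cnj (c k) * 1) = (\<Sum>j\<in>J. c j) * cnj (\<Sum>j\<in>J. c j)"
    by (simp add: sum_product)
  then show "0 \<le> Re (\<Sum>j\<in>J. \<Sum>k\<in>J. c j * cnj (c k) * 1)"
    by (simp add: complex_mult_cnj del: cnj_sum)
qed

lemma schur_multiplier_pos_kernel: "schur_multiplier J M \<Longrightarrow> pos_kernel J M"
  using pos_kernel_one[of J] unfolding schur_multiplier_def by fastforce

lemma schur_multiplier_cong:
  assumes "\<And>j k. j \<in> J \<Longrightarrow> k \<in> J \<Longrightarrow> M j k = N j k"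
  shows "schur_multiplier J M \<longleftrightarrow> schur_multiplier J N"
proof -
  have "(\<Sum>j\<in>J. \<Sum>k\<in>J. c j * cnj (c k) * (K j k * M j k)) = (\<Sum>j\<in>J. \<Sum>k\<in>J. c j * cnj (c k) * (K j k * N j k))"
    for c :: "'a \<Rightarrow> complex" and K using assms by (intro sum.cong) auto
  then show ?thesis unfolding schur_multiplier_def pos_kernel_def by simp
qed

lemma schur_multiplier_one: "schur_multiplier J (\<lambda>j k. 1)"
  unfolding schur_multiplier_def by simp

lemma schur_multiplier_mult:
  "schur_multiplier J M \<Longrightarrow> schur_multiplier J N \<Longrightarrow> schur_multiplier J (\<lambda>j k. M j k * N j k)"
  unfolding schur_multiplier_def by (simp add: mult.assoc[symmetric])

lemma schur_multiplier_power:
  "schur_multiplier J M \<Longrightarrow> schur_multiplier J (\<lambda>j k. M j k ^ n)"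
  by (induction n) (auto intro: schur_multiplier_one schur_multiplier_mult)

lemma schur_multiplier_add:
  assumes "schur_multiplier J M" "schur_multiplier J N"
  shows "schur_multiplier J (\<lambda>j k. M j k + N j k)"
  using assms unfolding schur_multiplier_def pos_kernel_def
  by (simp add: distrib_left sum.distrib del: Re_sum)

lemma schur_multiplier_scale:
  assumes "schur_multiplier J M" "0 \<le> r"
  shows "schur_multiplier J (\<lambda>j k. complex_of_real r * M j k)"
  unfolding schur_multiplier_def pos_kernel_def
proof (intro allI impI)
  fix K :: "'a \<Rightarrow> 'a \<Rightarrow> complex" and c :: "'a \<Rightarrow> complex"
  assume "\<forall>c. 0 \<le> Re (\<Sum>j\<in>J. \<Sum>k\<in>J. c j * cnj (c k) * K j k)"
  then have "0 \<le> Re (\<Sum>j\<in>J. \<Sum>k\<in>J. c j * cnj (c k) * (K j k * M j k))"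
    using assms(1) unfolding schur_multiplier_def pos_kernel_def by blast
  moreover have "(\<Sum>j\<in>J. \<Sum>k\<in>J. c j * cnj (c k) * (K j k * (complex_of_real r * M j k)))
    = complex_of_real r * (\<Sum>j\<in>J. \<Sum>k\<in>J. c j * cnj (c k) * (K j k * M j k))"
    by (simp add: sum_distrib_left mult_ac)
  ultimately show "0 \<le> Re (\<Sum>j\<in>J. \<Sum>k\<in>J. c j * cnj (c k) * (K j k * (complex_of_real r * M j k)))"
    using assms(2) by (simp del: Re_sum)
qed

text \<open>
  The factor \<open>f j * cnj (f k)\<close> is absorbed into the coefficients \<open>c\<close> of the quadratic form.
\<close>

lemma schur_multiplier_rank_one: "schur_multiplier J (\<lambda>j k. f j * cnj (f k))"
  unfolding schur_multiplier_def pos_kernel_def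
proof (intro allI impI)
  fix K :: "'a \<Rightarrow> 'a \<Rightarrow> complex" and c :: "'a \<Rightarrow> complex"
  assume "\<forall>c. 0 \<le> Re (\<Sum>j\<in>J. \<Sum>k\<in>J. c j * cnj (c k) * K j k)"
  from this[rule_format, of "\<lambda>j. c j * f j"]
  show "0 \<le> Re (\<Sum>j\<in>J. \<Sum>k\<in>J. c j * cnj (c k) * (K j k * (f j * cnj (f k))))"
    by (simp add: mult_ac del: Re_sum)
qed

lemma schur_multiplier_sum:
  assumes "\<And>i. i \<in> S \<Longrightarrow> schur_multiplier J (M i)"
  shows "schur_multiplier J (\<lambda>j k. \<Sum>i\<in>S. M i j k)"
proof (cases "finite S")
  case True
  then show ?thesis using assms
  proof (induction S)
    case empty
    have "schur_multiplier J (\<lambda>j k. complex_of_real 0 * 1)"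
      by (intro schur_multiplier_scale schur_multiplier_one) auto
    then show ?case by simp
  qed (auto intro: schur_multiplier_add)
next
  case False
  have "schur_multiplier J (\<lambda>j k. complex_of_real 0 * 1)"
    by (intro schur_multiplier_scale schur_multiplier_one) auto
  with False show ?thesis by simp
qed

lemma schur_multiplier_limit:
  assumes "\<And>n. schur_multiplier J (M n)"
    and "\<And>j k. j \<in> J \<Longrightarrow> k \<in> J \<Longrightarrow> (\<lambda>n. M n j k) \<longlonglongrightarrow> L j k"
  shows "schur_multiplier J L"
  unfolding schur_multiplier_def pos_kernel_def
proof (intro allI impI)
  fix K :: "'a \<Rightarrow> 'a \<Rightarrow> complex" and c :: "'a \<Rightarrow> complex"
  assume K: "\<forall>c. 0 \<le> Re (\<Sum>j\<in>J. \<Sum>k\<in>J. c j * cnj (c k) * K j k)"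
  have "(\<lambda>n. Re (\<Sum>j\<in>J. \<Sum>k\<in>J. c j * cnj (c k) * (K j k * M n j k)))
    \<longlonglongrightarrow> Re (\<Sum>j\<in>J. \<Sum>k\<in>J. c j * cnj (c k) * (K j k * L j k))"
    by (intro tendsto_intros assms(2))
  moreover have "0 \<le> Re (\<Sum>j\<in>J. \<Sum>k\<in>J. c j * cnj (c k) * (K j k * M n j k))" for n
    using assms(1)[of n] K unfolding schur_multiplier_def pos_kernel_def by blast
  ultimately show "0 \<le> Re (\<Sum>j\<in>J. \<Sum>k\<in>J. c j * cnj (c k) * (K j k * L j k))"
    by (intro LIMSEQ_le_const) auto
qed

lemma schur_multiplier_power_series:
  assumes "schur_multiplier J M" "\<And>n. 0 \<le> g n"
    and "\<And>j k. j \<in> J \<Longrightarrow> k \<in> J \<Longrightarrow> (\<lambda>n. complex_of_real (g n) * M j k ^ n) sums L j k"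
  shows "schur_multiplier J L"
proof (rule schur_multiplier_limit)
  show "schur_multiplier J (\<lambda>j k. \<Sum>i<n. complex_of_real (g i) * M j k ^ i)" for n
    by (intro schur_multiplier_sum schur_multiplier_scale schur_multiplier_power assms)
  show "(\<lambda>n. \<Sum>i<n. complex_of_real (g i) * M j k ^ i) \<longlonglongrightarrow> L j k" if "j \<in> J" "k \<in> J" for j k
    using assms(3)[OF that] unfolding sums_def .
qed

lemma exp_sums_complex: "(\<lambda>n. complex_of_real (1 / fact n) * z ^ n) sums exp z"
  using exp_converges[of z] by (simp add: scaleR_conv_of_real inverse_eq_divide)

lemma schur_multiplier_exp:
  assumes "schur_multiplier J M" shows "schur_multiplier J (\<lambda>j k. exp (M j k))"
  by (rule schur_multiplier_power_series[OF assms _ exp_sums_complex]) simp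

text \<open>
  The Taylor coefficients of \<open>exp z * (1 - e * z + e\<^sup>2 / 2 * z\<^sup>2)\<close> are
  \<open>(1 - e * n + e\<^sup>2 * n * (n - 1) / 2) / n!\<close> and nonnegative for \<open>0 \<le> e \<le> 1\<close>. The quadratic term is
  there for this reason only: if \<open>e > 0\<close>, the coefficients of \<open>exp z * (1 - e * z)\<close>
  are negative for large \<open>n\<close>.
\<close>

lemma schur_multiplier_exp_quadratic:
  assumes M: "schur_multiplier J M" and e: "0 \<le> e" "e \<le> 1"
  shows "schur_multiplier J (\<lambda>j k. exp (M j k) *
    (1 - complex_of_real e * M j k + complex_of_real (e\<^sup>2 / 2) * (M j k)\<^sup>2))"
proof (rule schur_multiplier_power_series[OF M])
  let ?g = "\<lambda>n. (1 - e * real n + e\<^sup>2 / 2 * real n * (real n - 1)) / fact n"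
  show "0 \<le> ?g n" for n
  proof -
    consider "n = 0" | "n = 1" | "n \<ge> 2" by linarith
    then have "0 \<le> 1 - e * real n + e\<^sup>2 / 2 * real n * (real n - 1)"
    proof cases
      case 3
      have "0 \<le> (1 - e * real n / 2)\<^sup>2 + e\<^sup>2 * real n * (real n - 2) / 4"
        using 3 by (intro add_nonneg_nonneg) auto
      also have "\<dots> = 1 - e * real n + e\<^sup>2 / 2 * real n * (real n - 1)"
        by (simp add: power2_eq_square field_simps)
      finally show ?thesis .
    qed (use e in auto)
    then show ?thesis by simp
  qed
  fix j k
  let ?z = "M j k"
  have s0: "(\<lambda>n. complex_of_real (1 / fact n) * ?z ^ n) sums exp ?z" by (rule exp_sums_complex)
  have s1: "(\<lambda>n. complex_of_real (real n / fact n) * ?z ^ n) sums (?z * exp ?z)"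
  proof -
    have "complex_of_real (real (Suc n) / fact (Suc n)) = complex_of_real (1 / fact n)" for n
      by (simp del: of_nat_Suc)
    then have "(\<lambda>n. complex_of_real (real (Suc n) / fact (Suc n)) * ?z ^ Suc n) sums (?z * exp ?z)"
      using sums_mult[OF s0, of ?z] by (simp only: power_Suc mult.left_commute)
    from sums_Suc[OF this] show ?thesis by simp
  qed
  have s2: "(\<lambda>n. complex_of_real (real n * (real n - 1) / fact n) * ?z ^ n) sums (?z\<^sup>2 * exp ?z)"
  proof -
    have "complex_of_real (real (Suc n) * (real (Suc n) - 1) / fact (Suc n)) = complex_of_real (real n / fact n)" for n
      by (simp add: divide_simps)
    then have "(\<lambda>n. complex_of_real (real (Suc n) * (real (Suc n) - 1) / fact (Suc n)) * ?z ^ Suc n) sums (?z * (?z * exp ?z))"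
      using sums_mult[OF s1, of ?z] by (simp only: power_Suc mult.left_commute)
    from sums_Suc[OF this] show ?thesis by (simp add: power2_eq_square mult.assoc)
  qed
  have "(\<lambda>n. complex_of_real (1 / fact n) * ?z ^ n - complex_of_real e * (complex_of_real (real n / fact n) * ?z ^ n)
      + complex_of_real (e\<^sup>2 / 2) * (complex_of_real (real n * (real n - 1) / fact n) * ?z ^ n))
    sums (exp ?z - complex_of_real e * (?z * exp ?z) + complex_of_real (e\<^sup>2 / 2) * (?z\<^sup>2 * exp ?z))"
    by (intro sums_add sums_diff sums_mult s0 s1 s2)
  moreover have "complex_of_real (1 / fact n) * ?z ^ n - complex_of_real e * (complex_of_real (real n / fact n) * ?z ^ n)
      + complex_of_real (e\<^sup>2 / 2) * (complex_of_real (real n * (real n - 1) / fact n) * ?z ^ n)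
    = complex_of_real (?g n) * ?z ^ n" for n
    by (simp add: field_simps)
  ultimately show "(\<lambda>n. complex_of_real (?g n) * ?z ^ n) sums
      (exp ?z * (1 - complex_of_real e * ?z + complex_of_real (e\<^sup>2 / 2) * ?z\<^sup>2))"
    by (simp add: algebra_simps)
qed

text \<open>
  An integral of kernels of rank one. Positivity of the quadratic form holds under the integral sign.
\<close>

lemma schur_multiplier_integral:
  assumes J: "finite J"
    and int: "\<And>j k. j \<in> J \<Longrightarrow> k \<in> J \<Longrightarrow> integrable M (\<lambda>x. f j x * cnj (f k x))"
  shows "schur_multiplier J (\<lambda>j k. \<integral>x. f j x * cnj (f k x) \<partial>M)"
  unfolding schur_multiplier_def pos_kernel_def
proof (intro allI impI)
  fix K :: "'a \<Rightarrow> 'a \<Rightarrow> complex" and c :: "'a \<Rightarrow> complex"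
  assume K: "\<forall>c. 0 \<le> Re (\<Sum>j\<in>J. \<Sum>k\<in>J. c j * cnj (c k) * K j k)"
  let ?h = "\<lambda>x. \<Sum>j\<in>J. \<Sum>k\<in>J. (c j * cnj (c k) * K j k) * (f j x * cnj (f k x))"
  have "(\<Sum>j\<in>J. \<Sum>k\<in>J. c j * cnj (c k) * (K j k * (\<integral>x. f j x * cnj (f k x) \<partial>M)))
    = (\<Sum>j\<in>J. \<Sum>k\<in>J. (\<integral>x. (c j * cnj (c k) * K j k) * (f j x * cnj (f k x)) \<partial>M))"
    by (simp add: mult.assoc)
  also have "\<dots> = (\<integral>x. ?h x \<partial>M)"
    using int by (simp add: Bochner_Integration.integral_sum)
  finally have eq: "(\<Sum>j\<in>J. \<Sum>k\<in>J. c j * cnj (c k) * (K j k * (\<integral>x. f j x * cnj (f k x) \<partial>M)))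
    = (\<integral>x. ?h x \<partial>M)" .
  have "integrable M ?h" using int by (intro Bochner_Integration.integrable_sum integrable_mult_right) auto
  then have "Re (\<integral>x. ?h x \<partial>M) = (\<integral>x. Re (?h x) \<partial>M)" by (rule integral_Re[symmetric])
  also have "\<dots> \<ge> 0"
  proof (rule integral_nonneg_AE, rule AE_I2)
    fix x
    from K[rule_format, of "\<lambda>j. c j * f j x"]
    show "0 \<le> Re (?h x)" by (simp add: mult_ac del: Re_sum)
  qed
  finally show "0 \<le> Re (\<Sum>j\<in>J. \<Sum>k\<in>J. c j * cnj (c k) * (K j k * (\<integral>x. f j x * cnj (f k x) \<partial>M)))"
    unfolding eq .
qed

text \<open>
  The Cholesky factorisation of a positive semidefinite matrix, by induction on the size: splitting
  off the rank one matrix of the vector \<open>w\<close> clears the row and column of \<open>i\<close> and leaves a positive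
  semidefinite matrix on \<open>I\<close>.
\<close>

lemma psd_gram_decomposition:
  fixes B :: "'i \<Rightarrow> 'i \<Rightarrow> real"
  assumes "finite I" "\<And>s t. B s t = B t s"
    and "\<And>a. 0 \<le> (\<Sum>s\<in>I. \<Sum>t\<in>I. a s * a t * B s t)"
  shows "\<exists>v. \<forall>s\<in>I. \<forall>t\<in>I. B s t = (\<Sum>l\<in>I. v l s * v l t)"
  using assms
proof (induction I arbitrary: B rule: finite_induct)
  case empty
  then show ?case by simp
next
  case (insert i I)
  note sym = insert.prems(1)
  have expand: "(\<Sum>s\<in>insert i I. \<Sum>t\<in>insert i I. a s * a t * C s t)
      = a i * a i * C i i + 2 * a i * (\<Sum>t\<in>I. a t * C i t) + (\<Sum>s\<in>I. \<Sum>t\<in>I. a s * a t * C s t)"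
    if "\<And>s t. C s t = C t s" for a and C :: "'i \<Rightarrow> 'i \<Rightarrow> real"
  proof -
    have "(\<Sum>s\<in>I. a s * a i * C s i) = a i * (\<Sum>t\<in>I. a t * C i t)"
      using that by (simp add: sum_distrib_left mult_ac)
    moreover have "(\<Sum>t\<in>I. a i * a t * C i t) = a i * (\<Sum>t\<in>I. a t * C i t)"
      by (simp add: sum_distrib_left mult_ac)
    ultimately show ?thesis using insert.hyps by (simp add: sum.distrib)
  qed
  have psd: "0 \<le> a i * a i * B i i + 2 * a i * (\<Sum>t\<in>I. a t * B i t) + (\<Sum>s\<in>I. \<Sum>t\<in>I. a s * a t * B s t)" for a
    using insert.prems(2)[of a] expand[of B a] sym by simp
  have Bii: "0 \<le> B i i"
  proof -
    define a where "a s = (if s = i then 1 else 0 :: real)" for s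
    have "a t = 0" if "t \<in> I" for t using that insert.hyps by (auto simp: a_def)
    then have "(\<Sum>t\<in>I. a t * B i t) = 0" "(\<Sum>s\<in>I. \<Sum>t\<in>I. a s * a t * B s t) = 0" by simp_all
    then show ?thesis using psd[of a] by (simp add: a_def)
  qed
  \<comment> \<open>If \<open>B i i = 0\<close>, then \<open>w\<close> is zero since division by zero is zero,
    and the row of \<open>i\<close> vanishes anyway, by the fact \<open>zero\<close> below.\<close>
  define w where "w s = B i s / sqrt (B i i)" for s
  define C where "C s t = B s t - w s * w t" for s t
  have zero: "B i t = 0" if "t \<in> I" "B i i = 0" for t
  proof (rule ccontr)
    assume nz: "B i t \<noteq> 0"
    have ti: "t \<noteq> i" using that insert.hyps by auto
    \<comment> \<open>With this value the quadratic form at \<open>r\<close> times the \<open>i\<close>-th plus the \<open>t\<close>-th unit vector is \<open>- 1\<close>.\<close>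
    define r where "r = - (B t t + 1) / (2 * B i t)"
    define a where "a s = (if s = i then r else if s = t then 1 else 0)" for s
    have a: "a i = r" "a t = 1" "\<And>s. s \<in> I - {t} \<Longrightarrow> a s = 0"
      using ti insert.hyps by (auto simp: a_def)
    have single: "(\<Sum>s\<in>I. a s * f s) = f t" for f
      using sum.remove[OF insert.hyps(1) that(1), of "\<lambda>s. a s * f s"] a by simp
    have 1: "(\<Sum>u\<in>I. a u * B i u) = B i t" by (rule single)
    have "(\<Sum>s\<in>I. \<Sum>u\<in>I. a s * a u * B s u) = (\<Sum>s\<in>I. a s * (\<Sum>u\<in>I. a u * B s u))"
      by (simp add: sum_distrib_left mult.assoc)
    also have "\<dots> = B t t" by (simp only: single)
    finally have 2: "(\<Sum>s\<in>I. \<Sum>u\<in>I. a s * a u * B s u) = B t t" .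
    have "0 \<le> 2 * r * B i t + B t t" using psd[of a] that(2) unfolding 1 2 a by simp
    moreover have "2 * r * B i t = - (B t t + 1)" using nz by (simp add: r_def)
    ultimately show False by linarith
  qed
  have wi: "w i * w t = B i t" if "t \<in> insert i I" for t
  proof (cases "B i i = 0")
    case True
    then show ?thesis using that zero by (auto simp: w_def)
  next
    case False
    then show ?thesis using Bii by (simp add: w_def field_simps)
  qed
  have "\<exists>v. \<forall>s\<in>I. \<forall>t\<in>I. C s t = (\<Sum>l\<in>I. v l s * v l t)"
  proof (rule insert.IH)
    show "C s t = C t s" for s t unfolding C_def using sym[of s t] by simp
    fix a
    have sw: "(\<Sum>s\<in>I. \<Sum>t\<in>I. a s * a t * (w s * w t)) = (\<Sum>t\<in>I. a t * w t)\<^sup>2"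
      by (simp add: power2_eq_square sum_product mult_ac)
    show "0 \<le> (\<Sum>s\<in>I. \<Sum>t\<in>I. a s * a t * C s t)"
    proof (cases "B i i = 0")
      case True
      then have "w s = 0" for s by (simp add: w_def)
      moreover have "(\<Sum>s\<in>I. \<Sum>t\<in>I. (a(i:=0)) s * (a(i:=0)) t * B s t) = (\<Sum>s\<in>I. \<Sum>t\<in>I. a s * a t * B s t)"
        using insert.hyps by (intro sum.cong) auto
      ultimately show ?thesis using psd[of "a(i := 0)"] by (simp add: C_def)
    next
      case False
      let ?m = "\<Sum>t\<in>I. a t * B i t"
      \<comment> \<open>The value at \<open>i\<close> that minimises the quadratic form gives the Schur complement.\<close>
      let ?a = "a(i := - ?m / B i i)"
      have 1: "(\<Sum>s\<in>I. \<Sum>t\<in>I. ?a s * ?a t * B s t) = (\<Sum>s\<in>I. \<Sum>t\<in>I. a s * a t * B s t)"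
        using insert.hyps by (intro sum.cong) auto
      have 2: "(\<Sum>t\<in>I. ?a t * B i t) = ?m" using insert.hyps by (intro sum.cong) auto
      have 3: "(\<Sum>t\<in>I. a t * w t)\<^sup>2 = ?m\<^sup>2 / B i i"
        using Bii by (simp add: w_def sum_divide_distrib[symmetric] power_divide)
      have "0 \<le> (\<Sum>s\<in>I. \<Sum>t\<in>I. a s * a t * B s t) - ?m\<^sup>2 / B i i"
        using psd[of ?a] False unfolding 1 2 by (simp add: power2_eq_square field_simps)
      also have "\<dots> = (\<Sum>s\<in>I. \<Sum>t\<in>I. a s * a t * C s t)"
        unfolding C_def 3[symmetric] sw[symmetric] by (simp add: algebra_simps sum_subtractf)
      finally show ?thesis .
    qed
  qed
  then obtain v where v: "\<And>s t. s \<in> I \<Longrightarrow> t \<in> I \<Longrightarrow> C s t = (\<Sum>l\<in>I. v l s * v l t)" by blast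
  define v' where "v' l s = (if l = i then w s else if s = i then 0 else v l s)" for l s
  have "B s t = (\<Sum>l\<in>insert i I. v' l s * v' l t)" if st: "s \<in> insert i I" "t \<in> insert i I" for s t
  proof -
    have "(\<Sum>l\<in>insert i I. v' l s * v' l t) = w s * w t + (\<Sum>l\<in>I. (if s = i \<or> t = i then 0 else v l s * v l t))"
      using insert.hyps by (simp add: v'_def) (intro sum.cong, auto)
    also have "\<dots> = B s t"
    proof (cases "s = i \<or> t = i")
      case True
      then show ?thesis using wi[of s] wi[of t] sym[of s i] st by (auto simp: mult.commute)
    next
      case False
      then show ?thesis using v[of s t] st by (simp add: C_def)
    qed
    finally show ?thesis by simp
  qed
  then show ?case by blast
qed

lemma schur_multiplier_bilinear:
  fixes B :: "'i \<Rightarrow> 'i \<Rightarrow> real" and u :: "'j \<Rightarrow> 'i \<Rightarrow> real"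
  assumes "finite I" "\<And>s t. B s t = B t s"
    and "\<And>a. 0 \<le> (\<Sum>s\<in>I. \<Sum>t\<in>I. a s * a t * B s t)"
  shows "schur_multiplier J (\<lambda>j k. complex_of_real (\<Sum>s\<in>I. \<Sum>t\<in>I. u j s * u k t * B s t))"
proof -
  obtain v where v: "\<And>s t. s \<in> I \<Longrightarrow> t \<in> I \<Longrightarrow> B s t = (\<Sum>l\<in>I. v l s * v l t)"
    using psd_gram_decomposition[of I B, OF assms] by blast
  define p where "p l j = (\<Sum>s\<in>I. u j s * v l s)" for l j
  have gram: "(\<Sum>s\<in>I. \<Sum>t\<in>I. u j s * u k t * B s t) = (\<Sum>l\<in>I. p l j * p l k)" for j k
  proof -
    have "(\<Sum>s\<in>I. \<Sum>t\<in>I. u j s * u k t * B s t) = (\<Sum>s\<in>I. \<Sum>t\<in>I. \<Sum>l\<in>I. (u j s * v l s) * (u k t * v l t))"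
      by (intro sum.cong refl) (simp add: v sum_distrib_left mult_ac)
    also have "\<dots> = (\<Sum>s\<in>I. \<Sum>l\<in>I. \<Sum>t\<in>I. (u j s * v l s) * (u k t * v l t))"
      by (intro sum.cong refl sum.swap)
    also have "\<dots> = (\<Sum>l\<in>I. \<Sum>s\<in>I. \<Sum>t\<in>I. (u j s * v l s) * (u k t * v l t))"
      by (rule sum.swap)
    also have "\<dots> = (\<Sum>l\<in>I. p l j * p l k)"
      by (simp add: p_def sum_product)
    finally show ?thesis .
  qed
  have "schur_multiplier J (\<lambda>j k. \<Sum>l\<in>I. complex_of_real (p l j) * cnj (complex_of_real (p l k)))"
    by (intro schur_multiplier_sum schur_multiplier_rank_one)
  then show ?thesis unfolding gram by simp
qed

section \<open>Signed measures with positive definite Fourier transform\<close>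

definition fourier :: "('t \<Rightarrow> real) measure \<Rightarrow> ('t \<Rightarrow> real) \<Rightarrow> complex" where
  "fourier \<mu> a = (\<integral>x. iexp (pairing a x) \<partial>\<mu>)"

lemma integrable_iexp_pairing:
  assumes "finite_measure \<mu>" "sets \<mu> = sets (cyl UNIV)"
  shows "integrable \<mu> (\<lambda>x. iexp (pairing a x))"
proof -
  interpret finite_measure \<mu> by fact
  have [measurable]: "pairing a \<in> borel_measurable \<mu>"
    using measurable_pairing measurable_cong_sets[OF assms(2) refl] by blast
  show ?thesis by (rule integrable_const_bound[of _ 1]) auto
qed

text \<open>
  Positive definiteness says that \<open>\<lambda> = (\<Sum>i\<in>F. w i * \<mu> i)\<close> integrates the square \<open>\<bar>p\<bar>\<^sup>2\<close> of every trigonometric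
  polynomial \<open>p\<close> to a nonnegative number. This passes to the squares of the functions in the uniform
  closure, and from these to indicators, as \<open>\<bar>f\<^sup>2 - 1\<^sub>A\<bar> \<le> 2 * \<bar>f - 1\<^sub>A\<bar>\<close> for \<open>0 \<le> f \<le> 1\<close>.
\<close>

lemma nonnegative_if_fourier_positive_definite:
  fixes \<mu> :: "'i \<Rightarrow> ('t \<Rightarrow> real) measure" and w :: "'i \<Rightarrow> real"
  assumes F: "finite F" and fin: "\<And>i. i \<in> F \<Longrightarrow> finite_measure (\<mu> i)"
    and sets_\<mu>: "\<And>i. i \<in> F \<Longrightarrow> sets (\<mu> i) = sets (cyl UNIV)"
    and pos: "\<And>J. finite J \<Longrightarrow> (\<And>a. a \<in> J \<Longrightarrow> finite (supp a)) \<Longrightarrow>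
      pos_kernel J (\<lambda>a b. \<Sum>i\<in>F. complex_of_real (w i) * fourier (\<mu> i) (\<lambda>t. a t - b t))"
    and A: "A \<in> sets (cyl UNIV)"
  shows "0 \<le> (\<Sum>i\<in>F. w i * measure (\<mu> i) A)"
proof -
  have int: "integrable (\<mu> i) f" if "i \<in> F" "f \<in> borel_measurable (cyl UNIV)" "\<And>x. \<bar>f x\<bar> \<le> B"
    for i B and f :: "_ \<Rightarrow> real"
  proof -
    interpret finite_measure "\<mu> i" by (rule fin) fact
    show ?thesis using that measurable_cong_sets[OF sets_\<mu>[OF that(1)] refl]
      by (intro integrable_const_bound[of _ B]) auto
  qed
  have trig: "0 \<le> (\<Sum>i\<in>F. w i * (\<integral>x. (p x)\<^sup>2 \<partial>\<mu> i))" if p: "real_trig p" for p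
  proof -
    obtain J c where J: "finite J" "\<And>a. a \<in> J \<Longrightarrow> finite (supp a)"
      and pJ: "(\<lambda>x. complex_of_real (p x)) = (\<lambda>x. \<Sum>a\<in>J. c a * iexp (pairing a x))"
      using trig_poly_expansion[OF p[unfolded real_trig_def]] by blast
    have sq: "complex_of_real ((p x)\<^sup>2)
        = (\<Sum>a\<in>J. \<Sum>b\<in>J. c a * cnj (c b) * iexp (pairing (\<lambda>t. a t - b t) x))" for x
    proof -
      have "complex_of_real ((p x)\<^sup>2) = complex_of_real (p x) * cnj (complex_of_real (p x))"
        by (simp add: power2_eq_square)
      also have "\<dots> = (\<Sum>a\<in>J. c a * iexp (pairing a x)) * cnj (\<Sum>a\<in>J. c a * iexp (pairing a x))"
        using fun_cong[OF pJ, of x] by simp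
      also have "\<dots> = (\<Sum>a\<in>J. \<Sum>b\<in>J. (c a * iexp (pairing a x)) * cnj (c b * iexp (pairing b x)))"
        by (simp add: sum_product)
      also have "\<dots> = (\<Sum>a\<in>J. \<Sum>b\<in>J. c a * cnj (c b) * iexp (pairing (\<lambda>t. a t - b t) x))"
      proof (intro sum.cong refl)
        fix a b assume "a \<in> J" "b \<in> J"
        then have "pairing (\<lambda>t. a t - b t) x = pairing a x - pairing b x"
          using J(2) by (intro pairing_diff) auto
        then show "(c a * iexp (pairing a x)) * cnj (c b * iexp (pairing b x))
            = c a * cnj (c b) * iexp (pairing (\<lambda>t. a t - b t) x)"
          by (simp add: exp_cnj exp_diff exp_minus right_diff_distrib divide_inverse mult_ac)
      qed
      finally show ?thesis .
    qed
    have "complex_of_real (\<integral>x. (p x)\<^sup>2 \<partial>\<mu> i)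
        = (\<Sum>a\<in>J. \<Sum>b\<in>J. c a * cnj (c b) * fourier (\<mu> i) (\<lambda>t. a t - b t))" if i: "i \<in> F" for i
    proof -
      note I = integrable_iexp_pairing[OF fin[OF i] sets_\<mu>[OF i]]
      have "complex_of_real (\<integral>x. (p x)\<^sup>2 \<partial>\<mu> i) = (\<integral>x. complex_of_real ((p x)\<^sup>2) \<partial>\<mu> i)"
        by (rule integral_complex_of_real[symmetric])
      also have "\<dots> = (\<Sum>a\<in>J. \<Sum>b\<in>J. c a * cnj (c b) * fourier (\<mu> i) (\<lambda>t. a t - b t))"
        unfolding sq fourier_def
        by (subst Bochner_Integration.integral_sum Bochner_Integration.integral_mult_right_zero,
            intro Bochner_Integration.integrable_sum integrable_mult_right I)+
           (simp add: Bochner_Integration.integral_sum integrable_mult_right I)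
      finally show ?thesis .
    qed
    then have "complex_of_real (\<Sum>i\<in>F. w i * (\<integral>x. (p x)\<^sup>2 \<partial>\<mu> i))
        = (\<Sum>i\<in>F. complex_of_real (w i) * (\<Sum>a\<in>J. \<Sum>b\<in>J. c a * cnj (c b) * fourier (\<mu> i) (\<lambda>t. a t - b t)))"
      by simp
    also have "\<dots> = (\<Sum>i\<in>F. \<Sum>a\<in>J. \<Sum>b\<in>J. c a * cnj (c b) * (complex_of_real (w i) * fourier (\<mu> i) (\<lambda>t. a t - b t)))"
      by (simp add: sum_distrib_left mult_ac)
    also have "\<dots> = (\<Sum>a\<in>J. \<Sum>i\<in>F. \<Sum>b\<in>J. c a * cnj (c b) * (complex_of_real (w i) * fourier (\<mu> i) (\<lambda>t. a t - b t)))"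
      by (rule sum.swap)
    also have "\<dots> = (\<Sum>a\<in>J. \<Sum>b\<in>J. \<Sum>i\<in>F. c a * cnj (c b) * (complex_of_real (w i) * fourier (\<mu> i) (\<lambda>t. a t - b t)))"
      by (intro sum.cong refl sum.swap)
    also have "\<dots> = (\<Sum>a\<in>J. \<Sum>b\<in>J. c a * cnj (c b) * (\<Sum>i\<in>F. complex_of_real (w i) * fourier (\<mu> i) (\<lambda>t. a t - b t)))"
      by (simp add: sum_distrib_left)
    finally have eq: "complex_of_real (\<Sum>i\<in>F. w i * (\<integral>x. (p x)\<^sup>2 \<partial>\<mu> i))
      = (\<Sum>a\<in>J. \<Sum>b\<in>J. c a * cnj (c b) * (\<Sum>i\<in>F. complex_of_real (w i) * fourier (\<mu> i) (\<lambda>t. a t - b t)))" .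
    have "0 \<le> Re (complex_of_real (\<Sum>i\<in>F. w i * (\<integral>x. (p x)\<^sup>2 \<partial>\<mu> i)))"
      unfolding eq using pos[OF J, unfolded pos_kernel_def] by (rule spec)
    then show ?thesis by (simp only: Re_complex_of_real)
  qed
  have unif: "0 \<le> (\<Sum>i\<in>F. w i * (\<integral>x. (f x)\<^sup>2 \<partial>\<mu> i))" if f: "uniform_trig f" for f
  proof -
    obtain B where B: "\<And>x. \<bar>f x\<bar> \<le> B" using uniform_trig_bounded[OF f] by blast
    have "\<forall>n. \<exists>p. real_trig p \<and> (\<forall>x. \<bar>f x - p x\<bar> < 1 / real (Suc n))"
      using f unfolding uniform_trig_def by simp
    then obtain p where p: "\<And>n. real_trig (p n)" "\<And>n x. \<bar>f x - p n x\<bar> < 1 / real (Suc n)" by metis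
    have p_lim: "(\<lambda>n. p n x) \<longlonglongrightarrow> f x" for x
    proof -
      have "(\<lambda>n. f x - p n x) \<longlonglongrightarrow> 0"
        by (rule Lim_null_comparison[OF _ lim_1_over_n[THEN LIMSEQ_Suc]])
           (use p(2) in \<open>auto intro!: always_eventually simp: less_imp_le\<close>)
      from tendsto_diff[OF tendsto_const[of "f x"] this] show ?thesis by simp
    qed
    have p_bd: "\<bar>p n x\<bar> \<le> B + 1" for n x
    proof -
      have "1 / real (Suc n) \<le> 1" by simp
      then show ?thesis using p(2)[of x n] B[of x] by linarith
    qed
    have "(\<lambda>n. \<integral>x. (p n x)\<^sup>2 \<partial>\<mu> i) \<longlonglongrightarrow> (\<integral>x. (f x)\<^sup>2 \<partial>\<mu> i)" if i: "i \<in> F" for i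
    proof (rule integral_dominated_convergence[where w = "\<lambda>_. (B + 1)\<^sup>2"])
      have m: "g \<in> borel_measurable (\<mu> i)" if "g \<in> borel_measurable (cyl UNIV)" for g :: "_ \<Rightarrow> real"
        using that measurable_cong_sets[OF sets_\<mu>[OF i] refl] by blast
      show "(\<lambda>x. (f x)\<^sup>2) \<in> borel_measurable (\<mu> i)" "\<And>n. (\<lambda>x. (p n x)\<^sup>2) \<in> borel_measurable (\<mu> i)"
        using m[OF uniform_trig_measurable[OF f]] m[OF real_trig_measurable[OF p(1)]] by measurable
      show "integrable (\<mu> i) (\<lambda>_. (B + 1)\<^sup>2)" by (rule int[OF i, of _ "(B + 1)\<^sup>2"]) auto
      show "AE x in \<mu> i. (\<lambda>n. (p n x)\<^sup>2) \<longlonglongrightarrow> (f x)\<^sup>2" by (intro AE_I2 tendsto_intros p_lim)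
      show "AE x in \<mu> i. norm ((p n x)\<^sup>2) \<le> (B + 1)\<^sup>2" for n
      proof (rule AE_I2)
        show "norm ((p n x)\<^sup>2) \<le> (B + 1)\<^sup>2" for x
          using power_mono[OF p_bd[of n x], where n = 2] by simp
      qed
    qed
    then have "(\<lambda>n. \<Sum>i\<in>F. w i * (\<integral>x. (p n x)\<^sup>2 \<partial>\<mu> i)) \<longlonglongrightarrow> (\<Sum>i\<in>F. w i * (\<integral>x. (f x)\<^sup>2 \<partial>\<mu> i))"
      by (intro tendsto_intros)
    then show ?thesis by (rule LIMSEQ_le_const) (use trig[OF p(1)] in blast)
  qed
  define C where "C = (\<Sum>i\<in>F. \<bar>w i\<bar>)"
  have C: "0 \<le> C" unfolding C_def by (intro sum_nonneg) auto
  have main: "0 \<le> (\<Sum>i\<in>F. w i * measure (\<mu> i) A) + 2 * C * e" if e: "e > 0" for e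
  proof -
    obtain f where f: "uniform_trig f" "\<And>x. 0 \<le> f x" "\<And>x. f x \<le> 1"
      and close: "\<And>i. i \<in> F \<Longrightarrow> (\<integral>x. \<bar>indicator A x - f x\<bar> \<partial>\<mu> i) < e"
      using indicator_approximation[of F \<mu>, OF F fin sets_\<mu> A e] by blast
    have fm: "f \<in> borel_measurable (cyl UNIV)" by (rule uniform_trig_measurable[OF f(1)])
    have f2: "\<bar>(f x)\<^sup>2\<bar> \<le> 1" for x using power_mono[OF f(3)[of x] f(2)[of x], where n = 2] f(2)[of x] by simp
    have near: "\<bar>(\<integral>x. (f x)\<^sup>2 \<partial>\<mu> i) - measure (\<mu> i) A\<bar> \<le> 2 * e" if i: "i \<in> F" for i
    proof -
      have i1: "integrable (\<mu> i) (\<lambda>x. (f x)\<^sup>2)" using fm f2 by (intro int[OF i]) auto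
      have i2: "integrable (\<mu> i) (indicator A :: _ \<Rightarrow> real)"
        using A by (intro int[OF i, of _ 1]) (auto simp: indicator_def)
      have i3: "integrable (\<mu> i) (\<lambda>x. \<bar>indicator A x - f x\<bar>)"
        using A fm f by (intro int[OF i, of _ 1]) (auto simp: indicator_def)
      have "A \<in> sets (\<mu> i)" using A sets_\<mu>[OF i] by simp
      then have "measure (\<mu> i) A = (\<integral>x. indicator A x \<partial>\<mu> i)"
        using sets.sets_into_space by (simp add: Int_absorb2)
      then have "\<bar>(\<integral>x. (f x)\<^sup>2 \<partial>\<mu> i) - measure (\<mu> i) A\<bar> = \<bar>\<integral>x. (f x)\<^sup>2 - indicator A x \<partial>\<mu> i\<bar>"
        using i1 i2 by (simp only: Bochner_Integration.integral_diff)
      also have "\<dots> \<le> (\<integral>x. \<bar>(f x)\<^sup>2 - indicator A x\<bar> \<partial>\<mu> i)" by (rule integral_abs_bound)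
      also have "\<dots> \<le> (\<integral>x. 2 * \<bar>indicator A x - f x\<bar> \<partial>\<mu> i)"
      proof (rule integral_mono)
        show "\<bar>(f x)\<^sup>2 - indicator A x\<bar> \<le> 2 * \<bar>indicator A x - f x\<bar>" for x
        proof -
          have "(indicator A x)\<^sup>2 = (indicator A x :: real)" by (auto simp: indicator_def)
          then have "(f x)\<^sup>2 - indicator A x = (f x + indicator A x) * (f x - indicator A x)"
            by (simp add: algebra_simps power2_eq_square)
          then have "\<bar>(f x)\<^sup>2 - indicator A x\<bar> = \<bar>f x + indicator A x\<bar> * \<bar>f x - indicator A x\<bar>"
            by (simp add: abs_mult)
          also have "\<dots> \<le> 2 * \<bar>f x - indicator A x\<bar>"
            using f(2,3)[of x] by (intro mult_right_mono) (auto simp: indicator_def)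
          finally show ?thesis by (simp add: abs_minus_commute)
        qed
      qed (use i1 i2 i3 in auto)
      also have "\<dots> \<le> 2 * e" using close[OF i] by simp
      finally show ?thesis .
    qed
    have "w i * (\<integral>x. (f x)\<^sup>2 \<partial>\<mu> i) \<le> w i * measure (\<mu> i) A + \<bar>w i\<bar> * (2 * e)" if i: "i \<in> F" for i
    proof -
      have "w i * ((\<integral>x. (f x)\<^sup>2 \<partial>\<mu> i) - measure (\<mu> i) A) \<le> \<bar>w i\<bar> * \<bar>(\<integral>x. (f x)\<^sup>2 \<partial>\<mu> i) - measure (\<mu> i) A\<bar>"
        by (simp add: abs_mult[symmetric])
      also have "\<dots> \<le> \<bar>w i\<bar> * (2 * e)" by (intro mult_left_mono near i) auto
      finally show ?thesis by (simp add: right_diff_distrib)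
    qed
    then have "(\<Sum>i\<in>F. w i * (\<integral>x. (f x)\<^sup>2 \<partial>\<mu> i)) \<le> (\<Sum>i\<in>F. w i * measure (\<mu> i) A + \<bar>w i\<bar> * (2 * e))"
      by (rule sum_mono)
    also have "\<dots> = (\<Sum>i\<in>F. w i * measure (\<mu> i) A) + C * (2 * e)"
      by (simp only: sum.distrib C_def sum_distrib_right)
    finally show ?thesis using unif[OF f(1)] by (simp add: mult_ac)
  qed
  have lower: "- (\<Sum>i\<in>F. w i * measure (\<mu> i) A) \<le> 2 * C * e" if "e > 0" for e
    using main[OF that] by linarith
  have "- (\<Sum>i\<in>F. w i * measure (\<mu> i) A) \<le> 0 + d" if d: "d > 0" for d
  proof -
    have "d / (2 * C + 1) > 0" using C d by simp
    from lower[OF this] have "- (\<Sum>i\<in>F. w i * measure (\<mu> i) A) \<le> 2 * C * (d / (2 * C + 1))" .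
    also have "\<dots> \<le> d" using C d by (simp add: field_simps)
    finally show ?thesis by simp
  qed
  then have "- (\<Sum>i\<in>F. w i * measure (\<mu> i) A) \<le> 0" by (rule field_le_epsilon)
  then show ?thesis by simp
qed

section \<open>The Levy-Khintchine exponent\<close>

lemma levy_measure_sets: "levy_measure \<nu> \<Longrightarrow> sets \<nu> = sets (cyl UNIV)"
  by (simp add: levy_measure_def)

lemma levy_measure_measurable:
  assumes "levy_measure \<nu>" shows "borel_measurable \<nu> = borel_measurable (cyl UNIV)"
  using measurable_cong_sets[OF levy_measure_sets[OF assms] refl] by blast

text \<open>
  If all coordinates are at most 1 in absolute value, the truncation has no effect and the second
  order Taylor estimate applies. Otherwise the sum on the right is at least 1 and a bound by a
  constant suffices.
\<close>

lemma norm_levy_khintchine_integrand_le: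
  assumes I: "finite I"
  shows "norm (iexp (\<Sum>t\<in>I. a t * x t) - 1
      - \<i> * complex_of_real (\<Sum>t\<in>I. a t * x t * indicator {y. \<bar>y\<bar> \<le> 1} (x t)))
    \<le> (2 + (\<Sum>t\<in>I. \<bar>a t\<bar>) + (\<Sum>t\<in>I. \<bar>a t\<bar>)\<^sup>2) * (\<Sum>t\<in>I. min (\<bar>x t\<bar>\<^sup>2) 1)"
proof -
  define K where "K = (\<Sum>t\<in>I. \<bar>a t\<bar>)"
  define m where "m = (\<Sum>t\<in>I. min (\<bar>x t\<bar>\<^sup>2) 1)"
  define y where "y = (\<Sum>t\<in>I. a t * x t)"
  define z where "z = (\<Sum>t\<in>I. a t * x t * indicator {y. \<bar>y\<bar> \<le> 1} (x t))"
  have K: "0 \<le> K" unfolding K_def by (intro sum_nonneg) auto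
  have m: "0 \<le> m" unfolding m_def by (intro sum_nonneg) auto
  have le_m: "min (\<bar>x t\<bar>\<^sup>2) 1 \<le> m" if "t \<in> I" for t
    unfolding m_def using I that by (intro member_le_sum) auto
  have "norm (iexp y - 1 - \<i> * complex_of_real z) \<le> (2 + K + K\<^sup>2) * m"
  proof (cases "\<forall>t\<in>I. \<bar>x t\<bar> \<le> 1")
    case True
    then have zy: "z = y" unfolding z_def y_def by (intro sum.cong) auto
    have x_le: "\<bar>x t\<bar> \<le> sqrt m" if "t \<in> I" for t
    proof -
      have "\<bar>x t\<bar>\<^sup>2 \<le> 1" using True that power_le_one[of "\<bar>x t\<bar>" 2] by simp
      then have "\<bar>x t\<bar>\<^sup>2 \<le> m" using le_m[OF that] by simp
      then show ?thesis by (rule real_le_rsqrt)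
    qed
    have "\<bar>y\<bar> \<le> (\<Sum>t\<in>I. \<bar>a t * x t\<bar>)" unfolding y_def by (rule sum_abs)
    also have "\<dots> \<le> (\<Sum>t\<in>I. \<bar>a t\<bar> * sqrt m)"
      using x_le by (intro sum_mono) (auto simp: abs_mult intro: mult_left_mono)
    also have "\<dots> = K * sqrt m" by (simp add: K_def sum_distrib_right)
    finally have "\<bar>y\<bar>\<^sup>2 \<le> (K * sqrt m)\<^sup>2" by (rule power_mono) simp
    then have y2: "\<bar>y\<bar>\<^sup>2 \<le> K\<^sup>2 * m" using m by (simp add: power_mult_distrib)
    have "norm (iexp y - 1 - \<i> * complex_of_real y) \<le> \<bar>y\<bar>\<^sup>2 / 2"
      using iexp_approx1[of y 1] by (simp add: numeral_2_eq_2 diff_diff_eq)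
    also have "\<dots> \<le> K\<^sup>2 * m" using y2 mult_nonneg_nonneg[OF zero_le_power2 m, of K] by linarith
    also have "\<dots> \<le> (2 + K + K\<^sup>2) * m" using K m by (intro mult_right_mono) auto
    finally show ?thesis unfolding zy .
  next
    case False
    then obtain t where t: "t \<in> I" "\<not> \<bar>x t\<bar> \<le> 1" by blast
    then have "1 \<le> \<bar>x t\<bar>\<^sup>2" using one_le_power[of "\<bar>x t\<bar>" 2] by simp
    then have m1: "1 \<le> m" using le_m[OF t(1)] by simp
    have "\<bar>z\<bar> \<le> (\<Sum>t\<in>I. \<bar>a t * x t * indicator {y. \<bar>y\<bar> \<le> 1} (x t)\<bar>)"
      unfolding z_def by (rule sum_abs)
    also have "\<dots> \<le> K" unfolding K_def
      by (intro sum_mono) (auto simp: abs_mult indicator_def mult_left_le)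
    finally have "norm (\<i> * complex_of_real z) \<le> K" by (simp add: norm_mult)
    moreover have "norm (iexp y - 1) \<le> norm (iexp y) + norm (1::complex)" by (rule norm_triangle_ineq4)
    ultimately have "norm (iexp y - 1 - \<i> * complex_of_real z) \<le> 2 + K"
      using norm_triangle_ineq4[of "iexp y - 1" "\<i> * complex_of_real z"] by simp
    also have "\<dots> \<le> (2 + K + K\<^sup>2) * 1" by simp
    also have "\<dots> \<le> (2 + K + K\<^sup>2) * m" using K m1 by (intro mult_left_mono) auto
    finally show ?thesis .
  qed
  then show ?thesis unfolding K_def m_def y_def z_def .
qed

lemma integrable_levy_khintchine:
  assumes \<nu>: "levy_measure \<nu>" and I: "finite I"
  shows "integrable \<nu> (\<lambda>x. iexp (\<Sum>t\<in>I. a t * x t) - 1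
      - \<i> * complex_of_real (\<Sum>t\<in>I. a t * x t * indicator {y. \<bar>y\<bar> \<le> 1} (x t)))"
proof (rule Bochner_Integration.integrable_bound)
  let ?K = "2 + (\<Sum>t\<in>I. \<bar>a t\<bar>) + (\<Sum>t\<in>I. \<bar>a t\<bar>)\<^sup>2"
  have "integrable \<nu> (\<lambda>x. min (\<bar>x t\<bar>\<^sup>2) 1)" for t
  proof (rule integrableI_nonneg)
    show "(\<lambda>x. min (\<bar>x t\<bar>\<^sup>2) 1) \<in> borel_measurable \<nu>"
      unfolding levy_measure_measurable[OF \<nu>] by measurable
    show "(\<integral>\<^sup>+ x. ennreal (min (\<bar>x t\<bar>\<^sup>2) 1) \<partial>\<nu>) < \<infinity>" using \<nu> by (simp add: levy_measure_def)
  qed simp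
  then show "integrable \<nu> (\<lambda>x. ?K * (\<Sum>t\<in>I. min (\<bar>x t\<bar>\<^sup>2) 1))" by simp
  show "(\<lambda>x. iexp (\<Sum>t\<in>I. a t * x t) - 1
      - \<i> * complex_of_real (\<Sum>t\<in>I. a t * x t * indicator {y. \<bar>y\<bar> \<le> 1} (x t))) \<in> borel_measurable \<nu>"
    unfolding levy_measure_measurable[OF \<nu>] by measurable
  show "AE x in \<nu>. norm (iexp (\<Sum>t\<in>I. a t * x t) - 1
      - \<i> * complex_of_real (\<Sum>t\<in>I. a t * x t * indicator {y. \<bar>y\<bar> \<le> 1} (x t)))
    \<le> norm (?K * (\<Sum>t\<in>I. min (\<bar>x t\<bar>\<^sup>2) 1))"
    by (rule AE_I2, rule order_trans[OF norm_levy_khintchine_integrand_le[OF I]]) simp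
qed

lemma iexp_pairing_diff:
  assumes "finite (supp a)" "finite (supp b)"
  shows "iexp (pairing (\<lambda>t. a t - b t) x) = iexp (pairing a x) * cnj (iexp (pairing b x))"
  using pairing_diff[OF assms, of x]
  by (simp add: exp_cnj exp_diff exp_minus right_diff_distrib divide_inverse)

text \<open>
  The formula is stated for the law \<open>\<mu>\<close> of the process on \<open>\<real>\<^sup>T\<close>, because the argument compares \<open>\<mu>\<close> with its
  convolutions.
\<close>

definition levy_khintchine_formula ::
  "('t \<Rightarrow> real) measure \<Rightarrow> ('t \<Rightarrow> 't \<Rightarrow> real) \<Rightarrow> ('t \<Rightarrow> real) \<Rightarrow> ('t \<Rightarrow> real) measure \<Rightarrow> bool" where
  "levy_khintchine_formula \<mu> \<Sigma> \<beta> \<nu> \<longleftrightarrow>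
    (\<forall>I a. finite I \<and> I \<noteq> {} \<longrightarrow>
       (\<integral>x. iexp (\<Sum>t\<in>I. a t * x t) \<partial>\<mu>) =
       exp (- complex_of_real (1 / 2 * (\<Sum>s\<in>I. \<Sum>t\<in>I. a s * a t * \<Sigma> s t))
            + (\<integral>x. (iexp (\<Sum>t\<in>I. a t * x t) - 1
                    - \<i> * complex_of_real (\<Sum>t\<in>I. a t * x t * indicator {y. \<bar>y\<bar> \<le> 1} (x t))) \<partial>\<nu>)
            + \<i> * complex_of_real (\<Sum>t\<in>I. a t * \<beta> t)))"

lemma finite_measure_restricted_density:
  assumes "D \<in> sets M" "emeasure M D < \<infinity>"
  shows "finite_measure (density M (indicator D))"
proof
  have "emeasure (density M (indicator D)) (space (density M (indicator D))) = emeasure M (D \<inter> space M)"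
    using assms(1) by (simp add: emeasure_restricted)
  also have "\<dots> = emeasure M D"
    using sets.sets_into_space[OF assms(1)] by (simp add: Int_absorb2)
  finally show "emeasure (density M (indicator D)) (space (density M (indicator D))) \<noteq> \<infinity>"
    using assms(2) by simp
qed

text \<open>
  Let \<open>\<psi>\<close> be the Levy-Khintchine exponent, \<open>k\<close> the Fourier transform of \<open>\<nu>\<close> restricted to \<open>D\<close>, and
  \<open>f a = exp (\<i> \<langle>a, x\<rangle>) - 1\<close>. Since the compensating terms are linear in the frequency,
  \<open>\<psi>(a - b) - \<psi>(a) - cnj (\<psi>(b))\<close> is the covariance \<open>Q a b\<close> plus \<open>\<integral>f a * cnj (f b) \<partial>\<nu>\<close>. On \<open>D\<close> the last
  integral equals \<open>k(a - b)\<close> up to terms that depend on only one of \<open>a\<close> and \<open>b\<close>; the rest of it is a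
  kernel \<open>N a b\<close> that is an integral of rank one kernels. Hence the Fourier transform of \<open>\<mu>\<close> at
  \<open>a - b\<close> has the form \<open>w a * cnj (w b) * exp (Q a b) * exp (N a b) * exp (k (a - b))\<close>. All factors are
  Schur multipliers, and the last one remains so after multiplication by the quadratic
  polynomial in \<open>k\<close>.
\<close>

lemma levy_khintchine_pos_kernel:
  fixes \<mu> \<nu> :: "('t \<Rightarrow> real) measure"
  assumes \<nu>: "levy_measure \<nu>" and \<Sigma>: "nonneg_definite \<Sigma>"
    and LK: "levy_khintchine_formula \<mu> \<Sigma> \<beta> \<nu>"
    and D: "D \<in> sets \<nu>" "emeasure \<nu> D < \<infinity>"
    and J: "finite J" "\<And>a. a \<in> J \<Longrightarrow> finite (supp a)"
    and e: "0 \<le> e" "e \<le> 1"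
  defines "k \<equiv> fourier (density \<nu> (indicator D))"
  shows "pos_kernel J (\<lambda>a b. fourier \<mu> (\<lambda>t. a t - b t) *
    (1 - complex_of_real e * k (\<lambda>t. a t - b t) + complex_of_real (e\<^sup>2 / 2) * (k (\<lambda>t. a t - b t))\<^sup>2))"
proof -
  \<comment> \<open>An arbitrary index is added because the formula is stated for nonempty index sets.\<close>
  define I where "I = insert undefined (\<Union>a\<in>J. supp a)"
  have I: "finite I" "I \<noteq> {}" using J by (auto simp: I_def)
  have supp_I: "supp a \<subseteq> I" if "a \<in> J" for a using that by (auto simp: I_def)
  have pair_I: "(\<Sum>t\<in>I. a t * x t) = pairing a x" if "a \<in> J" for a x
    using pairing_eq_sum[OF I(1) supp_I[OF that]] by simp
  have pair_diff_I: "(\<Sum>t\<in>I. (a t - b t) * x t) = pairing (\<lambda>t. a t - b t) x" if "a \<in> J" "b \<in> J" for a b x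
  proof -
    have "supp (\<lambda>t. a t - b t) \<subseteq> supp a \<union> supp b" by (auto simp: supp_def)
    also have "\<dots> \<subseteq> I" using supp_I that by simp
    finally have "supp (\<lambda>t. a t - b t) \<subseteq> I" .
    from pairing_eq_sum[OF I(1) this] show ?thesis by simp
  qed
  note meas = levy_measure_measurable[OF \<nu>]
  define \<rho> where "\<rho> = density \<nu> (indicator D)"
  have k: "k = fourier \<rho>" by (simp add: k_def \<rho>_def)
  have sets_\<rho>: "sets \<rho> = sets (cyl UNIV)" by (simp add: \<rho>_def levy_measure_sets[OF \<nu>])
  have fin_\<rho>: "finite_measure \<rho>" unfolding \<rho>_def by (rule finite_measure_restricted_density[OF D])
  define c where "c = measure \<rho> (space \<rho>)"
  note int_\<rho> = integrable_iexp_pairing[OF fin_\<rho> sets_\<rho>]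

  define lk where "lk a x = iexp (\<Sum>t\<in>I. a t * x t) - 1
      - \<i> * complex_of_real (\<Sum>t\<in>I. a t * x t * indicator {y. \<bar>y\<bar> \<le> 1} (x t))" for a x :: "'t \<Rightarrow> real"
  define L where "L a = (\<integral>x. lk a x \<partial>\<nu>)" for a
  define Q where "Q a b = (\<Sum>s\<in>I. \<Sum>t\<in>I. a s * b t * \<Sigma> s t)" for a b
  define f where "f a x = iexp (pairing a x) - 1" for a x :: "'t \<Rightarrow> real"
  define g where "g a x = f a x * indicator (- D) x" for a x
  define N where "N a b = (\<integral>x. g a x * cnj (g b x) \<partial>\<nu>)" for a b
  have f_meas: "f a \<in> borel_measurable \<nu>" for a unfolding meas f_def by measurable
  have int_lk: "integrable \<nu> (lk a)" for a
    unfolding lk_def by (rule integrable_levy_khintchine[OF \<nu> I(1)])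
  have lk_diff: "lk (\<lambda>t. a t - b t) x = lk a x + cnj (lk b x) + f a x * cnj (f b x)"
    if ab: "a \<in> J" "b \<in> J" for a b x
  proof -
    have "iexp (pairing (\<lambda>t. a t - b t) x) = iexp (pairing a x) * cnj (iexp (pairing b x))"
      using ab J by (intro iexp_pairing_diff) auto
    then show ?thesis
      unfolding lk_def f_def pair_diff_I[OF ab] pair_I[OF ab(1)] pair_I[OF ab(2)]
      by (simp add: algebra_simps sum_subtractf)
  qed
  have int_ff: "integrable \<nu> (\<lambda>x. f a x * cnj (f b x))" if ab: "a \<in> J" "b \<in> J" for a b
  proof -
    have "integrable \<nu> (\<lambda>x. lk (\<lambda>t. a t - b t) x - lk a x - cnj (lk b x))"
      by (intro Bochner_Integration.integrable_diff int_lk integrable_cnj)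
    then show ?thesis unfolding lk_diff[OF ab] by simp
  qed
  have int_gg: "integrable \<nu> (\<lambda>x. g a x * cnj (g b x))" if ab: "a \<in> J" "b \<in> J" for a b
  proof -
    have "- D \<in> sets \<nu>"
      using sets.compl_sets[OF D(1)] levy_measure_sets[OF \<nu>] sets_eq_imp_space_eq[OF levy_measure_sets[OF \<nu>]]
      by (simp add: space_cyl Compl_eq_Diff_UNIV)
    from integrable_mult_indicator[OF this int_ff[OF ab]]
    have "integrable \<nu> (\<lambda>x. indicator (- D) x *\<^sub>R (f a x * cnj (f b x)))" .
    moreover have "indicator (- D) x *\<^sub>R (f a x * cnj (f b x)) = g a x * cnj (g b x)" for x
      by (simp add: g_def indicator_def)
    ultimately show ?thesis by simp
  qed
  have N_D: "(\<integral>x. f a x * cnj (f b x) \<partial>\<rho>) = k (\<lambda>t. a t - b t) - k a - cnj (k b) + complex_of_real c"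
    if ab: "a \<in> J" "b \<in> J" for a b
  proof -
    have *: "f a x * cnj (f b x)
      = iexp (pairing (\<lambda>t. a t - b t) x) - iexp (pairing a x) - cnj (iexp (pairing b x)) + 1" for x
      using J ab by (subst iexp_pairing_diff) (auto simp: f_def algebra_simps)
    interpret finite_measure \<rho> by (rule fin_\<rho>)
    have "(\<integral>x. f a x * cnj (f b x) \<partial>\<rho>)
      = (\<integral>x. iexp (pairing (\<lambda>t. a t - b t) x) - iexp (pairing a x) - cnj (iexp (pairing b x)) \<partial>\<rho>) + (\<integral>x. 1 \<partial>\<rho>)"
      unfolding * by (intro Bochner_Integration.integral_add Bochner_Integration.integrable_diff int_\<rho> integrable_cnj) simp
    also have "(\<integral>x. iexp (pairing (\<lambda>t. a t - b t) x) - iexp (pairing a x) - cnj (iexp (pairing b x)) \<partial>\<rho>)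
      = (\<integral>x. iexp (pairing (\<lambda>t. a t - b t) x) - iexp (pairing a x) \<partial>\<rho>) - (\<integral>x. cnj (iexp (pairing b x)) \<partial>\<rho>)"
      by (intro Bochner_Integration.integral_diff Bochner_Integration.integrable_diff int_\<rho> integrable_cnj)
    also have "(\<integral>x. iexp (pairing (\<lambda>t. a t - b t) x) - iexp (pairing a x) \<partial>\<rho>)
      = k (\<lambda>t. a t - b t) - k a"
      unfolding k fourier_def by (intro Bochner_Integration.integral_diff int_\<rho>)
    also have "(\<integral>x. cnj (iexp (pairing b x)) \<partial>\<rho>) = cnj (k b)"
      unfolding k fourier_def by (rule Bochner_Integration.integral_cnj)
    also have "(\<integral>x. 1 \<partial>\<rho>) = complex_of_real c" by (simp add: c_def scaleR_conv_of_real)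
    finally show ?thesis .
  qed
  have L_diff: "L (\<lambda>t. a t - b t) = L a + cnj (L b) + (N a b + (k (\<lambda>t. a t - b t) - k a - cnj (k b) + complex_of_real c))"
    if ab: "a \<in> J" "b \<in> J" for a b
  proof -
    have "(\<integral>x. f a x * cnj (f b x) \<partial>\<nu>) = (\<integral>x. g a x * cnj (g b x) + indicator D x *\<^sub>R (f a x * cnj (f b x)) \<partial>\<nu>)"
      by (intro Bochner_Integration.integral_cong) (auto simp: g_def indicator_def)
    also have "\<dots> = N a b + (\<integral>x. indicator D x *\<^sub>R (f a x * cnj (f b x)) \<partial>\<nu>)"
      unfolding N_def
      by (intro Bochner_Integration.integral_add int_gg ab integrable_mult_indicator D int_ff)
    also have "(\<integral>x. indicator D x *\<^sub>R (f a x * cnj (f b x)) \<partial>\<nu>) = (\<integral>x. f a x * cnj (f b x) \<partial>\<rho>)"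
    proof -
      have \<rho>': "\<rho> = density \<nu> (\<lambda>x. ennreal (indicator D x))" unfolding \<rho>_def by (simp add: ennreal_indicator)
      show ?thesis unfolding \<rho>'
        using D(1) borel_measurable_integrable[OF int_ff[OF ab]]
        by (intro integral_density[symmetric]) auto
    qed
    finally have ff: "(\<integral>x. f a x * cnj (f b x) \<partial>\<nu>)
      = N a b + (k (\<lambda>t. a t - b t) - k a - cnj (k b) + complex_of_real c)" unfolding N_D[OF ab] .
    have "L (\<lambda>t. a t - b t) = (\<integral>x. lk a x + cnj (lk b x) \<partial>\<nu>) + (\<integral>x. f a x * cnj (f b x) \<partial>\<nu>)"
      unfolding L_def lk_diff[OF ab]
      by (intro Bochner_Integration.integral_add Bochner_Integration.integrable_add int_lk integrable_cnj int_ff ab)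
    also have "(\<integral>x. lk a x + cnj (lk b x) \<partial>\<nu>) = L a + cnj (L b)"
      unfolding L_def
      by (subst Bochner_Integration.integral_add) (auto intro: int_lk integrable_cnj)
    finally show ?thesis unfolding ff .
  qed
  have \<Sigma>_sym: "\<Sigma> s t = \<Sigma> t s" for s t using \<Sigma> by (simp add: nonneg_definite_def)
  have Q_diff: "Q (\<lambda>t. a t - b t) (\<lambda>t. a t - b t) = Q a a + Q b b - 2 * Q a b" for a b
  proof -
    have "Q b a = (\<Sum>t\<in>I. \<Sum>s\<in>I. b s * a t * \<Sigma> s t)" unfolding Q_def by (rule sum.swap)
    also have "\<dots> = Q a b" unfolding Q_def by (intro sum.cong refl) (simp add: \<Sigma>_sym mult_ac)
    finally have "Q b a = Q a b" .
    moreover have "Q (\<lambda>t. a t - b t) (\<lambda>t. a t - b t) = Q a a - Q a b - Q b a + Q b b"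
      unfolding Q_def by (simp add: algebra_simps sum_subtractf sum.distrib)
    ultimately show ?thesis by simp
  qed
  define \<beta>I where "\<beta>I a = (\<Sum>t\<in>I. a t * \<beta> t)" for a
  \<comment> \<open>The total mass \<open>c\<close> of \<open>\<rho>\<close> is divided evenly between \<open>w a\<close> and \<open>cnj (w b)\<close>.\<close>
  define w where "w a = exp (- complex_of_real (Q a a / 2) + L a + \<i> * complex_of_real (\<beta>I a) - k a + complex_of_real (c / 2))" for a
  have fourier_eq: "fourier \<mu> (\<lambda>t. a t - b t)
      = w a * cnj (w b) * exp (complex_of_real (Q a b)) * exp (N a b) * exp (k (\<lambda>t. a t - b t))"
    if ab: "a \<in> J" "b \<in> J" for a b
  proof -
    let ?d = "\<lambda>t. a t - b t"
    have "fourier \<mu> ?d = exp (- complex_of_real (1 / 2 * Q ?d ?d) + L ?d + \<i> * complex_of_real (\<beta>I ?d))"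
      using LK[unfolded levy_khintchine_formula_def, rule_format, of I ?d] I
      unfolding fourier_def pair_diff_I[OF ab, symmetric] Q_def L_def lk_def \<beta>I_def by simp
    also have "- complex_of_real (1 / 2 * Q ?d ?d) + L ?d + \<i> * complex_of_real (\<beta>I ?d)
      = (- complex_of_real (Q a a / 2) + L a + \<i> * complex_of_real (\<beta>I a) - k a + complex_of_real (c / 2))
      + cnj (- complex_of_real (Q b b / 2) + L b + \<i> * complex_of_real (\<beta>I b) - k b + complex_of_real (c / 2))
      + complex_of_real (Q a b) + N a b + k ?d"
    proof -
      have \<beta>I_diff: "\<beta>I ?d = \<beta>I a - \<beta>I b"
        unfolding \<beta>I_def by (simp add: algebra_simps sum_subtractf)
      show ?thesis unfolding L_diff[OF ab] Q_diff \<beta>I_diff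
        by (simp add: algebra_simps add_divide_distrib diff_divide_distrib)
    qed
    also have "exp \<dots> = w a * cnj (w b) * exp (complex_of_real (Q a b)) * exp (N a b) * exp (k ?d)"
      unfolding w_def exp_cnj by (simp only: exp_add)
    finally show ?thesis .
  qed
  have k_int: "k (\<lambda>t. a t - b t) = (\<integral>x. iexp (pairing a x) * cnj (iexp (pairing b x)) \<partial>\<rho>)"
    if ab: "a \<in> J" "b \<in> J" for a b
    unfolding k fourier_def using J ab by (subst iexp_pairing_diff) auto
  have "schur_multiplier J (\<lambda>a b. (\<integral>x. iexp (pairing a x) * cnj (iexp (pairing b x)) \<partial>\<rho>))"
  proof (rule schur_multiplier_integral[OF J(1)])
    fix a b assume "a \<in> J" "b \<in> J"
    then have "(\<lambda>x. iexp (pairing a x) * cnj (iexp (pairing b x))) = (\<lambda>x. iexp (pairing (\<lambda>t. a t - b t) x))"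
      using J by (intro ext iexp_pairing_diff[symmetric]) auto
    then show "integrable \<rho> (\<lambda>x. iexp (pairing a x) * cnj (iexp (pairing b x)))" using int_\<rho> by simp
  qed
  then have sm_k: "schur_multiplier J (\<lambda>a b. k (\<lambda>t. a t - b t))"
    using schur_multiplier_cong[of J "\<lambda>a b. k (\<lambda>t. a t - b t)", OF k_int] by blast
  have sm_N: "schur_multiplier J N" unfolding N_def by (rule schur_multiplier_integral[OF J(1) int_gg])
  have sm_Q: "schur_multiplier J (\<lambda>a b. complex_of_real (Q a b))"
    unfolding Q_def using \<Sigma> I by (intro schur_multiplier_bilinear) (auto simp: nonneg_definite_def)
  let ?q = "\<lambda>z. 1 - complex_of_real e * z + complex_of_real (e\<^sup>2 / 2) * z\<^sup>2"
  have "schur_multiplier J (\<lambda>a b. (w a * cnj (w b) * exp (complex_of_real (Q a b)) * exp (N a b)) *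
    (exp (k (\<lambda>t. a t - b t)) * ?q (k (\<lambda>t. a t - b t))))"
    by (intro schur_multiplier_mult schur_multiplier_rank_one schur_multiplier_exp sm_Q sm_N
        schur_multiplier_exp_quadratic sm_k e)
  moreover have "(w a * cnj (w b) * exp (complex_of_real (Q a b)) * exp (N a b)) *
    (exp (k (\<lambda>t. a t - b t)) * ?q (k (\<lambda>t. a t - b t)))
    = fourier \<mu> (\<lambda>t. a t - b t) * ?q (k (\<lambda>t. a t - b t))" if "a \<in> J" "b \<in> J" for a b
    unfolding fourier_eq[OF that] by (simp only: mult.assoc)
  ultimately have "schur_multiplier J (\<lambda>a b. fourier \<mu> (\<lambda>t. a t - b t) * ?q (k (\<lambda>t. a t - b t)))"
    by (subst (asm) schur_multiplier_cong) auto
  then show ?thesis by (rule schur_multiplier_pos_kernel)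
qed

section \<open>Adding a jump to the process\<close>

definition convolve :: "('t \<Rightarrow> real) measure \<Rightarrow> ('t \<Rightarrow> real) measure \<Rightarrow> ('t \<Rightarrow> real) measure" where
  "convolve \<mu> \<rho> = distr (\<mu> \<Otimes>\<^sub>M \<rho>) (cyl UNIV) (\<lambda>(x, y). \<lambda>t. x t + y t)"

lemma measurable_pointwise_add:
  fixes \<mu> \<rho> :: "('t \<Rightarrow> real) measure"
  assumes "sets \<mu> = sets (cyl UNIV)" "sets \<rho> = sets (cyl UNIV)"
  shows "(\<lambda>(x, y). \<lambda>t. x t + y t) \<in> measurable (\<mu> \<Otimes>\<^sub>M \<rho>) (cyl UNIV)"
proof -
  have "(\<lambda>z. \<lambda>t::'t. fst z t + snd z t) \<in> measurable (cyl UNIV \<Otimes>\<^sub>M cyl UNIV) (cyl UNIV)"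
  proof (rule measurable_PiM_single')
    fix t :: 't
    have t: "(\<lambda>x. x t) \<in> borel_measurable (cyl UNIV)" by (rule measurable_component_singleton) simp
    show "(\<lambda>z. fst z t + snd z t) \<in> borel_measurable (cyl UNIV \<Otimes>\<^sub>M cyl UNIV)"
      by (intro borel_measurable_add measurable_compose[OF measurable_fst t] measurable_compose[OF measurable_snd t])
  qed simp
  then show ?thesis
    unfolding case_prod_beta
    using measurable_cong_sets[OF sets_pair_measure_cong[OF assms] refl] by blast
qed

lemma sets_convolve: "sets (convolve \<mu> \<rho>) = sets (cyl UNIV)"
  by (simp add: convolve_def)

lemma finite_measure_convolve:
  assumes "finite_measure \<mu>" "finite_measure \<rho>"
    and "sets \<mu> = sets (cyl UNIV)" "sets \<rho> = sets (cyl UNIV)"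
  shows "finite_measure (convolve \<mu> \<rho>)"
  unfolding convolve_def
  by (intro finite_measure.finite_measure_distr finite_measure_pair_measure assms measurable_pointwise_add)

lemma fourier_convolve:
  assumes fin: "finite_measure \<mu>" "finite_measure \<rho>"
    and sets: "sets \<mu> = sets (cyl UNIV)" "sets \<rho> = sets (cyl UNIV)"
  shows "fourier (convolve \<mu> \<rho>) a = fourier \<mu> a * fourier \<rho> a"
proof -
  have [measurable]: "pairing a \<in> borel_measurable (cyl UNIV)" by (rule measurable_pairing)
  interpret M: finite_measure \<mu> by fact
  interpret R: finite_measure \<rho> by fact
  interpret pair_sigma_finite \<mu> \<rho> ..
  have pm: "pairing a \<in> borel_measurable M" if "sets M = sets (cyl UNIV)" for M :: "('a \<Rightarrow> real) measure"
    using measurable_pairing measurable_cong_sets[OF that refl] by blast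
  have int: "integrable (\<mu> \<Otimes>\<^sub>M \<rho>) (\<lambda>(x, y). iexp (pairing a x) * iexp (pairing a y))"
  proof -
    have [measurable]: "pairing a \<in> borel_measurable \<mu>" "pairing a \<in> borel_measurable \<rho>"
      using pm sets by auto
    interpret P: finite_measure "\<mu> \<Otimes>\<^sub>M \<rho>" by (rule finite_measure_pair_measure) fact+
    show ?thesis
      by (rule P.integrable_const_bound[of _ 1]) (auto simp: norm_mult case_prod_beta)
  qed
  have "fourier (convolve \<mu> \<rho>) a = (\<integral>z. iexp (pairing a (case z of (x, y) \<Rightarrow> \<lambda>t. x t + y t)) \<partial>(\<mu> \<Otimes>\<^sub>M \<rho>))"
    unfolding fourier_def convolve_def
  proof (rule integral_distr[OF measurable_pointwise_add[OF sets]])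
    show "(\<lambda>x. iexp (pairing a x)) \<in> borel_measurable (cyl UNIV)"
      by measurable
  qed
  also have "\<dots> = (\<integral>z. (case z of (x, y) \<Rightarrow> iexp (pairing a x) * iexp (pairing a y)) \<partial>(\<mu> \<Otimes>\<^sub>M \<rho>))"
    by (intro Bochner_Integration.integral_cong) (auto simp: pairing_plus_right exp_add distrib_left)
  also have "\<dots> = (\<integral>x. \<integral>y. iexp (pairing a x) * iexp (pairing a y) \<partial>\<rho> \<partial>\<mu>)"
    using integral_fst'[OF int] by (simp only: prod.case)
  also have "\<dots> = fourier \<mu> a * fourier \<rho> a"
    unfolding fourier_def by simp
  finally show ?thesis .
qed

text \<open>
  If \<open>X\<close> has law \<open>\<mu>\<close> and \<open>\<xi>\<close> is an independent path with law proportional to \<open>\<rho>\<close>, the restriction of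
  \<open>\<nu>\<close> to \<open>D\<close>, then the law of \<open>X + \<xi>\<close> is absolutely continuous with respect to the law of \<open>X\<close>.
  Intuitively, the jumps of \<open>X\<close> in \<open>D\<close> contribute an independent compound Poisson sum, and one more
  summand is again one of the possible values of that sum. In the proof, the signed measure
  \<open>\<mu> - e * (\<mu> * \<rho>) + e\<^sup>2 / 2 * (\<mu> * \<rho> * \<rho>)\<close> has a positive definite Fourier transform and is therefore nonnegative. On a \<open>\<mu>\<close>-null set this bounds \<open>\<mu> * \<rho>\<close> by
  \<open>e / 2 * (\<mu> * \<rho> * \<rho>)\<close>, where \<open>e\<close> is arbitrarily small.
\<close>

lemma convolve_levy_part_absolutely_continuous:
  fixes \<mu> \<nu> :: "('t \<Rightarrow> real) measure"
  assumes \<mu>: "finite_measure \<mu>" "sets \<mu> = sets (cyl UNIV)"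
    and \<nu>: "levy_measure \<nu>" and \<Sigma>: "nonneg_definite \<Sigma>"
    and LK: "levy_khintchine_formula \<mu> \<Sigma> \<beta> \<nu>"
    and D: "D \<in> sets \<nu>" "emeasure \<nu> D < \<infinity>"
    and A: "A \<in> sets (cyl UNIV)" "measure \<mu> A = 0"
  shows "measure (convolve \<mu> (density \<nu> (indicator D))) A = 0"
proof -
  define \<rho> where "\<rho> = density \<nu> (indicator D)"
  have sets_\<rho>: "sets \<rho> = sets (cyl UNIV)" by (simp add: \<rho>_def levy_measure_sets[OF \<nu>])
  have fin_\<rho>: "finite_measure \<rho>" unfolding \<rho>_def by (rule finite_measure_restricted_density[OF D])
  define \<mu>1 where "\<mu>1 = convolve \<mu> \<rho>"
  define \<mu>2 where "\<mu>2 = convolve \<mu>1 \<rho>"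
  have 1: "finite_measure \<mu>1" "sets \<mu>1 = sets (cyl UNIV)"
    unfolding \<mu>1_def by (rule finite_measure_convolve[OF \<mu>(1) fin_\<rho> \<mu>(2) sets_\<rho>], rule sets_convolve)
  have 2: "finite_measure \<mu>2" "sets \<mu>2 = sets (cyl UNIV)"
    unfolding \<mu>2_def by (rule finite_measure_convolve[OF 1(1) fin_\<rho> 1(2) sets_\<rho>], rule sets_convolve)
  have f1: "fourier \<mu>1 a = fourier \<mu> a * fourier \<rho> a" for a
    unfolding \<mu>1_def by (rule fourier_convolve[OF \<mu>(1) fin_\<rho> \<mu>(2) sets_\<rho>])
  have f2: "fourier \<mu>2 a = fourier \<mu> a * fourier \<rho> a * fourier \<rho> a" for a
    unfolding \<mu>2_def fourier_convolve[OF 1(1) fin_\<rho> 1(2) sets_\<rho>] f1 ..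
  have ineq: "e * measure \<mu>1 A \<le> e\<^sup>2 / 2 * measure \<mu>2 A" if e: "0 \<le> e" "e \<le> 1" for e
  proof -
    define m where "m i = (if i = 0 then \<mu> else if i = 1 then \<mu>1 else \<mu>2)" for i :: nat
    define w where "w i = (if i = 0 then 1 else if i = 1 then - e else e\<^sup>2 / 2)" for i :: nat
    have "0 \<le> (\<Sum>i\<in>{0, 1, 2}. w i * measure (m i) A)"
    proof (rule nonnegative_if_fourier_positive_definite[OF _ _ _ _ A(1)])
      show "finite_measure (m i)" "sets (m i) = sets (cyl UNIV)" for i
        using \<mu> 1 2 by (auto simp: m_def)
      fix J :: "('t \<Rightarrow> real) set" assume J: "finite J" "\<And>a. a \<in> J \<Longrightarrow> finite (supp a)"
      have "(\<Sum>i\<in>{0, 1, 2}. complex_of_real (w i) * fourier (m i) d)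
        = fourier \<mu> d * (1 - complex_of_real e * fourier \<rho> d + complex_of_real (e\<^sup>2 / 2) * (fourier \<rho> d)\<^sup>2)" for d
        by (simp add: w_def m_def f1 f2 algebra_simps power2_eq_square)
      then show "pos_kernel J (\<lambda>a b. \<Sum>i\<in>{0, 1, 2}. complex_of_real (w i) * fourier (m i) (\<lambda>t. a t - b t))"
        using levy_khintchine_pos_kernel[OF \<nu> \<Sigma> LK D J e] unfolding \<rho>_def by simp
    qed simp
    then show ?thesis using A(2) by (simp add: w_def m_def)
  qed
  define r where "r = measure \<mu>1 A"
  define s where "s = measure \<mu>2 A"
  have rs: "0 \<le> r" "0 \<le> s" by (simp_all add: r_def s_def)
  have "r \<le> 0"
  proof (rule ccontr)
    assume "\<not> r \<le> 0"
    then have r: "0 < r" by simp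
    define e where "e = min 1 (r / (s + 1))"
    have e: "0 < e" "e \<le> 1" using r rs by (auto simp: e_def)
    have "e * r \<le> e * (e * s / 2)"
      using ineq[of e] e by (simp add: r_def s_def power2_eq_square)
    then have "r \<le> e * s / 2" using e(1) by simp
    also have "\<dots> \<le> (r / (s + 1)) * s / 2"
      using rs by (intro divide_right_mono mult_right_mono) (auto simp: e_def)
    also have "\<dots> < r" using r rs by (simp add: field_simps add_strict_increasing2)
    finally show False by simp
  qed
  then have "r = 0" using rs(1) by simp
  then show ?thesis by (simp add: r_def \<mu>1_def \<rho>_def)
qed

section \<open>Retractions onto standard Borel subsets and countable dependence\<close>

text \<open>
  An extension from an arbitrary, possibly nonmeasurable subset. Rounding \<open>f\<close> to a dense sequence
  gives functions that are described by countably many sets in the trace \<open>\<sigma>\<close>-algebra, each of which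
  is the trace of a measurable set; these extend \<open>f\<close> approximately. By completeness their limit exists on
  the measurable set where they form a Cauchy sequence, which contains the whole of \<open>U\<close>.
\<close>

lemma polish_valued_extension:
  fixes f :: "'a \<Rightarrow> 'p :: polish_space"
  assumes f: "f \<in> borel_measurable (restrict_space M U)"
  obtains F where "F \<in> borel_measurable M" "\<And>x. x \<in> U \<inter> space M \<Longrightarrow> F x = f x"
proof -
  obtain Q :: "'p set" where Q: "countable Q" "\<And>X. open X \<Longrightarrow> X \<noteq> {} \<Longrightarrow> \<exists>d\<in>Q. d \<in> X"
    using countable_dense_exists[where 'a = 'p] by blast
  have "Q \<noteq> {}" using Q(2)[of UNIV] by auto
  define q where "q = from_nat_into Q"
  have dense: "\<exists>n. dist (q n) y < r" if "r > 0" for y r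
  proof -
    obtain d where "d \<in> Q" "d \<in> ball y r" using Q(2)[of "ball y r"] \<open>r > 0\<close> by auto
    moreover obtain n where "d = q n"
      using from_nat_into_surj[OF Q(1) \<open>d \<in> Q\<close>] unfolding q_def by metis
    ultimately show ?thesis by (auto simp: dist_commute)
  qed
  have "\<exists>A\<in>sets M. f -` ball (q n) (1 / Suc m) \<inter> space (restrict_space M U) = U \<inter> A" for n m
    using measurable_sets[OF f, of "ball (q n) (1 / Suc m)"] by (auto simp: sets_restrict_space image_iff)
  then obtain A where A: "\<And>n m. A n m \<in> sets M"
    "\<And>n m. f -` ball (q n) (1 / Suc m) \<inter> space (restrict_space M U) = U \<inter> A n m" by metis
  have A_iff: "x \<in> A n m \<longleftrightarrow> dist (q n) (f x) < 1 / Suc m" if "x \<in> U \<inter> space M" for x n m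
    using A(2)[of n m] that by (auto simp: space_restrict_space)
  define G where "G m x = q (LEAST n. x \<in> A n m)" for m x
  have G_meas: "G m \<in> borel_measurable M" for m
  proof -
    have [measurable]: "A n m \<in> sets M" for n by (rule A(1))
    have "(\<lambda>x. LEAST n. x \<in> A n m) \<in> measurable M (count_space UNIV)" by measurable
    then show ?thesis unfolding G_def by (rule measurable_compose) simp
  qed
  have G_close: "dist (G m x) (f x) < 1 / Suc m" if x: "x \<in> U \<inter> space M" for m x
  proof -
    obtain n where "dist (q n) (f x) < 1 / Suc m" using dense[of "1 / Suc m" "f x"] by auto
    then have "x \<in> A n m" using A_iff[OF x] by simp
    then have "x \<in> A (LEAST n. x \<in> A n m) m" by (rule LeastI)
    then show ?thesis unfolding G_def using A_iff[OF x] by simp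
  qed
  have G_lim: "(\<lambda>m. G m x) \<longlonglongrightarrow> f x" if x: "x \<in> U \<inter> space M" for x
  proof (rule metric_LIMSEQ_I)
    fix r :: real assume "r > 0"
    then obtain N where N: "1 / real (Suc N) < r" using nat_approx_posE by blast
    have "dist (G m x) (f x) < r" if "m \<ge> N" for m
    proof -
      have "1 / real (Suc m) \<le> 1 / real (Suc N)" using that by (simp add: frac_le)
      then show ?thesis using G_close[OF x, of m] N by simp
    qed
    then show "\<exists>N. \<forall>m\<ge>N. dist (G m x) (f x) < r" by blast
  qed
  define C where "C = {x \<in> space M. Cauchy (\<lambda>m. G m x)}"
  have C: "C \<in> sets M" unfolding C_def using G_meas by measurable
  define H where "H m x = (if x \<in> C then G m x else q 0)" for m x
  define F where "F x = lim (\<lambda>m. H m x)" for x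
  have H_meas: "H m \<in> borel_measurable M" for m
    unfolding H_def using G_meas C by measurable
  have "(\<lambda>m. H m x) \<longlonglongrightarrow> F x" if "x \<in> space M" for x
  proof (cases "x \<in> C")
    case True
    then have "convergent (\<lambda>m. H m x)" by (simp add: H_def C_def Cauchy_convergent)
    then show ?thesis unfolding F_def by (simp add: convergent_LIMSEQ_iff)
  next
    case False
    then show ?thesis unfolding F_def by (simp add: H_def)
  qed
  then have F_meas: "F \<in> borel_measurable M"
    by (rule borel_measurable_LIMSEQ_metric[OF H_meas])
  have "F x = f x" if x: "x \<in> U \<inter> space M" for x
  proof -
    have "x \<in> C" using x LIMSEQ_imp_Cauchy[OF G_lim[OF x]] by (simp add: C_def)
    then show ?thesis unfolding F_def H_def using limI[OF G_lim[OF x]] by simp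
  qed
  with F_meas that show thesis by blast
qed

text \<open>
  With \<open>f\<close> an isomorphism from \<open>U\<close> onto a Borel set \<open>B\<close>, \<open>g\<close> its inverse and \<open>F\<close> an extension of \<open>f\<close>, the
  retraction is \<open>g \<circ> F\<close> where \<open>F\<close> takes values in \<open>B\<close>, and the zero function elsewhere. The set \<open>N\<close> is the
  preimage under \<open>F\<close> of the single point \<open>f 0\<close>.
\<close>

lemma standard_borel_retraction:
  fixes U :: "('t \<Rightarrow> real) set"
  assumes "standard_borel_via TYPE('p::polish_space) (restrict_space (cyl UNIV) U)"
    and zero: "(\<lambda>t. 0) \<in> U"
  obtains h N where "h \<in> measurable (cyl UNIV) (restrict_space (cyl UNIV) U)"
    "\<And>x. x \<in> U \<Longrightarrow> h x = x" "N \<in> sets (cyl UNIV)" "N \<inter> U = {\<lambda>t. 0}"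
proof -
  let ?R = "restrict_space (cyl UNIV) U"
  have space_R: "space ?R = U" by (simp add: space_restrict_space space_cyl)
  obtain B and f :: "('t \<Rightarrow> real) \<Rightarrow> 'p" and g where B: "B \<in> sets borel"
    and f: "f \<in> measurable ?R (restrict_space borel B)"
    and g: "g \<in> measurable (restrict_space borel B) ?R"
    and gf: "\<And>x. x \<in> U \<Longrightarrow> g (f x) = x"
    using assms(1) unfolding standard_borel_via_def space_R by blast
  have fB: "f x \<in> B" if "x \<in> U" for x
    using measurable_space[OF f, of x] that by (simp add: space_R space_restrict_space space_cyl)
  have f': "f \<in> borel_measurable ?R" using f by (rule measurable_restrict_space2_iff[THEN iffD1, THEN conjunct1])
  obtain F where F: "F \<in> borel_measurable (cyl UNIV)" "\<And>x. x \<in> U \<Longrightarrow> F x = f x"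
    using polish_valued_extension[OF f'] by (auto simp: space_cyl)
  have F_sets: "{x. F x \<in> S} \<in> sets (cyl UNIV)" if "S \<in> sets borel" for S
    using measurable_sets[OF F(1) that] by (simp add: space_cyl vimage_def)
  define h where "h x = (if F x \<in> B then g (F x) else (\<lambda>t. 0))" for x
  have h: "h \<in> measurable (cyl UNIV) ?R"
    unfolding h_def
  proof (rule measurable_If_restrict_space_iff[THEN iffD2])
    show "{x \<in> space (cyl UNIV). F x \<in> B} \<in> sets (cyl UNIV)" using F_sets[OF B] by (simp add: space_cyl)
    have "F \<in> measurable (restrict_space (cyl UNIV) {x. F x \<in> B}) (restrict_space borel B)"
      by (intro measurable_restrict_space2 measurable_restrict_space1 F) (auto simp: space_restrict_space)
    then show "(\<lambda>x. g (F x)) \<in> measurable (restrict_space (cyl UNIV) {x. F x \<in> B}) ?R \<and>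
      (\<lambda>x t. 0) \<in> measurable (restrict_space (cyl UNIV) {x. F x \<notin> B}) ?R"
      using measurable_compose[OF _ g] zero by (auto simp: space_R)
  qed
  have hU: "h x = x" if "x \<in> U" for x using that by (simp add: h_def F fB gf)
  define N where "N = {x. F x \<in> {f (\<lambda>t. 0)}}"
  have "N \<in> sets (cyl UNIV)" unfolding N_def by (rule F_sets) simp
  moreover have "N \<inter> U = {\<lambda>t. 0}"
    unfolding N_def using zero F(2) gf by (auto, metis)
  ultimately show thesis using that h hU by blast
qed

lemma cyl_countably_determined:
  assumes "A \<in> sets (cyl UNIV :: ('t \<Rightarrow> real) measure)"
  obtains T where "countable T" "\<And>x y. (\<And>t. t \<in> T \<Longrightarrow> x t = y t) \<Longrightarrow> x \<in> A \<longleftrightarrow> y \<in> A"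
proof -
  have "A \<in> sigma_sets (\<Pi>\<^sub>E i\<in>UNIV. space borel) {{f \<in> \<Pi>\<^sub>E i\<in>UNIV. space borel. f i \<in> B} | i B. i \<in> UNIV \<and> B \<in> sets borel}"
    using assms unfolding sets_PiM_single by simp
  then have "\<exists>T. countable T \<and> (\<forall>x y. (\<forall>t\<in>T. x t = y t) \<longrightarrow> (x \<in> A \<longleftrightarrow> y \<in> A))"
  proof induction
    case (Basic A)
    then obtain i B where "A = {f. f i \<in> B}" by (auto simp: PiE_UNIV_domain)
    then show ?case by (intro exI[of _ "{i}"]) auto
  next
    case Empty
    then show ?case by (intro exI[of _ "{}"]) auto
  next
    case (Compl A)
    then show ?case by (auto simp: PiE_UNIV_domain)
  next
    case (Union A)
    then have "\<forall>i. \<exists>T. countable T \<and> (\<forall>x y. (\<forall>t\<in>T. x t = y t) \<longrightarrow> (x \<in> A i \<longleftrightarrow> y \<in> A i))" by blast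
    then obtain T where T: "\<forall>i. countable (T i) \<and> (\<forall>x y. (\<forall>t\<in>T i. x t = y t) \<longrightarrow> (x \<in> A i \<longleftrightarrow> y \<in> A i))"
      by (rule choice[THEN exE])
    show ?case
    proof (intro exI[of _ "\<Union>i. T i"] conjI allI impI)
      show "countable (\<Union>i. T i)" using T by blast
      fix x y :: "'t \<Rightarrow> real" assume "\<forall>t\<in>\<Union>i. T i. x t = y t"
      then have "\<forall>t\<in>T i. x t = y t" for i by simp
      then have "x \<in> A i \<longleftrightarrow> y \<in> A i" for i
        using T[THEN spec, of i, THEN conjunct2, THEN spec, of x, THEN spec, of y] by simp
      then show "x \<in> \<Union>(range A) \<longleftrightarrow> y \<in> \<Union>(range A)" by blast
    qed
  qed
  then obtain T where T: "countable T" "\<forall>x y. (\<forall>t\<in>T. x t = y t) \<longrightarrow> (x \<in> A \<longleftrightarrow> y \<in> A)"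
    by (elim exE conjE)
  show thesis
  proof (rule that[OF T(1)])
    fix x y :: "'t \<Rightarrow> real" assume "\<And>t. t \<in> T \<Longrightarrow> x t = y t"
    then show "x \<in> A \<longleftrightarrow> y \<in> A" using T(2)[THEN spec, of x, THEN spec, of y] by simp
  qed
qed

section \<open>A Levy measure does not charge sets missing the path group\<close>

text \<open>
  Suppose \<open>\<nu> D > 0\<close>; by \<open>\<sigma>\<close>-finiteness one may take \<open>\<nu> D\<close> finite. For every \<open>t\<close> the set \<open>{x. h x t \<noteq> x t}\<close>
  misses \<open>U\<close>, so it is null for the law of \<open>X\<close> and by absolute continuity for that of \<open>X + \<xi>\<close>, where \<open>\<xi>\<close>
  is distributed according to \<open>\<nu>\<close> on \<open>D\<close>. Let \<open>T\<close> be a countable set of coordinates that determines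
  \<open>D\<close>. Almost surely \<open>X + \<xi>\<close> coincides on \<open>T\<close> with the element \<open>h (X + \<xi>)\<close> of \<open>U\<close>, hence \<open>\<xi>\<close>
  coincides on \<open>T\<close> with \<open>h (X + \<xi>) - X\<close>. The latter is in \<open>U\<close> since \<open>U\<close> is a group, and in \<open>D\<close>
  since \<open>\<xi>\<close> is, although \<open>D\<close> and \<open>U\<close> are disjoint.
\<close>

lemma levy_measure_null_off_subgroup:
  fixes X :: "'t \<Rightarrow> 'w \<Rightarrow> real"
  assumes P: "prob_space P" and X: "\<And>t. X t \<in> borel_measurable P"
    and \<nu>: "levy_measure_of P X \<nu>" "sigma_finite_measure \<nu>"
    and paths: "paths_in P X U" and U: "additive_subgroup U"
    and h: "h \<in> measurable (cyl UNIV) (restrict_space (cyl UNIV) U)" "\<And>x. x \<in> U \<Longrightarrow> h x = x"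
    and D: "D \<in> sets (cyl UNIV)" "D \<inter> U = {}"
  shows "emeasure \<nu> D = 0"
proof -
  interpret P: prob_space P by fact
  have levy: "levy_measure \<nu>" using \<nu>(1) by (simp add: levy_measure_of_def)
  note sets_\<nu> = levy_measure_sets[OF levy]
  have space_\<nu>: "space \<nu> = UNIV" using sets_eq_imp_space_eq[OF sets_\<nu>] by (simp add: space_cyl)
  have Xm: "(\<lambda>\<omega> t. X t \<omega>) \<in> measurable P (cyl UNIV)"
    by (rule measurable_PiM_single') (use X in auto)
  define \<mu> where "\<mu> = distr P (cyl UNIV) (\<lambda>\<omega> t. X t \<omega>)"
  have sets_\<mu>: "sets \<mu> = sets (cyl UNIV)" by (simp add: \<mu>_def)
  have fin_\<mu>: "finite_measure \<mu>"
    unfolding \<mu>_def by (rule P.finite_measure_distr[OF Xm])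
  obtain \<Sigma> \<beta> where \<Sigma>: "nonneg_definite \<Sigma>" and LK: "levy_khintchine_formula \<mu> \<Sigma> \<beta> \<nu>"
  proof -
    have law: "(\<integral>x. iexp (\<Sum>t\<in>I. a t * x t) \<partial>\<mu>) = (\<integral>\<omega>. iexp (\<Sum>t\<in>I. a t * X t \<omega>) \<partial>P)" for I a
      unfolding \<mu>_def by (rule integral_distr[OF Xm]) measurable
    show thesis
      using \<nu>(1) that unfolding levy_measure_of_def levy_khintchine_formula_def law by blast
  qed
  have hU: "h x \<in> U" for x
    using measurable_space[OF h(1), of x] by (simp add: space_cyl space_restrict_space)
  have h': "h \<in> measurable (cyl UNIV) (cyl UNIV)"
    using h(1) by (rule measurable_restrict_space2_iff[THEN iffD1, THEN conjunct1])
  have diff: "(\<lambda>t. x t - y t) \<in> U" if "x \<in> U" "y \<in> U" for x y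
  proof -
    have add: "(\<lambda>t. p t + q t) \<in> U" if "p \<in> U" "q \<in> U" for p q
      using U that by (simp add: additive_subgroup_def)
    have "(\<lambda>t. - y t) \<in> U" using U that by (simp add: additive_subgroup_def)
    from add[OF that(1) this] show ?thesis by simp
  qed
  have finite_case: "emeasure \<nu> D = 0"
    if D: "D \<in> sets (cyl UNIV)" "D \<inter> U = {}" and fin: "emeasure \<nu> D < \<infinity>" for D
  proof (rule ccontr)
    assume pos: "emeasure \<nu> D \<noteq> 0"
    obtain T where T: "countable T" "\<And>x y. (\<And>t. t \<in> T \<Longrightarrow> x t = y t) \<Longrightarrow> x \<in> D \<longleftrightarrow> y \<in> D"
      using cyl_countably_determined[OF D(1)] by blast
    have D\<nu>: "D \<in> sets \<nu>" using D(1) sets_\<nu> by simp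
    define \<rho> where "\<rho> = density \<nu> (indicator D)"
    have sets_\<rho>: "sets \<rho> = sets (cyl UNIV)" by (simp add: \<rho>_def sets_\<nu>)
    interpret R: finite_measure \<rho> unfolding \<rho>_def by (rule finite_measure_restricted_density[OF D\<nu> fin])
    interpret M: finite_measure \<mu> by (rule fin_\<mu>)
    interpret MR: pair_sigma_finite \<mu> \<rho> ..
    define B where "B t = {x. h x t \<noteq> x t}" for t
    have B: "B t \<in> sets (cyl UNIV)" for t
    proof -
      have t: "(\<lambda>x. x t) \<in> borel_measurable (cyl UNIV)" by (rule measurable_component_singleton) simp
      have "{x \<in> space (cyl UNIV). h x t \<noteq> x t} \<in> sets (cyl UNIV)"
        by (rule borel_measurable_neq[OF measurable_compose[OF h' t] t])
      then show ?thesis by (simp add: B_def space_cyl)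
    qed
    have "emeasure \<mu> (B t) = 0" for t
    proof -
      have "(\<lambda>\<omega> t. X t \<omega>) -` B t \<inter> space P = {}"
        using paths h(2) by (auto simp: B_def paths_in_def)
      then show ?thesis unfolding \<mu>_def using B by (simp add: emeasure_distr[OF Xm])
    qed
    then have "measure \<mu> (B t) = 0" for t by (simp add: measure_def)
    then have "measure (convolve \<mu> \<rho>) (B t) = 0" for t
      unfolding \<rho>_def using B
      by (intro convolve_levy_part_absolutely_continuous[OF fin_\<mu> sets_\<mu> levy \<Sigma> LK D\<nu> fin])
    then have "B t \<in> null_sets (convolve \<mu> \<rho>)" for t
      using finite_measure.emeasure_eq_measure[OF finite_measure_convolve[OF fin_\<mu> R.finite_measure_axioms sets_\<mu> sets_\<rho>]]
        B by (intro null_setsI) (auto simp: sets_convolve)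
    then have "AE x in convolve \<mu> \<rho>. x \<notin> B t" for t by (rule AE_not_in)
    then have "AE z in \<mu> \<Otimes>\<^sub>M \<rho>. (case z of (x, y) \<Rightarrow> \<lambda>t. x t + y t) \<notin> B t" for t
      unfolding convolve_def by (rule AE_distrD[OF measurable_pointwise_add[OF sets_\<mu> sets_\<rho>]])
    then have "AE z in \<mu> \<Otimes>\<^sub>M \<rho>. \<forall>t\<in>T. (case z of (x, y) \<Rightarrow> \<lambda>t. x t + y t) \<notin> B t"
      using T(1) by (subst AE_ball_countable) auto
    from MR.AE_pair[OF this] have "AE x in \<mu>. AE y in \<rho>. \<forall>t\<in>T. (\<lambda>t. x t + y t) \<notin> B t"
      by simp
    then have "AE \<omega> in P. AE y in \<rho>. \<forall>t\<in>T. (\<lambda>t. X t \<omega> + y t) \<notin> B t"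
      unfolding \<mu>_def by (rule AE_distrD[OF Xm])
    then have "AE \<omega> in P. \<omega> \<in> space P \<and> (AE y in \<rho>. \<forall>t\<in>T. (\<lambda>t. X t \<omega> + y t) \<notin> B t)"
      using AE_space by eventually_elim simp
    moreover have "ae_filter P \<noteq> bot" by (simp add: ae_filter_eq_bot_iff P.emeasure_space_1)
    ultimately obtain \<omega> where \<omega>: "\<omega> \<in> space P" "AE y in \<rho>. \<forall>t\<in>T. (\<lambda>t. X t \<omega> + y t) \<notin> B t"
      using eventually_happens' by blast
    have "AE y in \<rho>. y \<in> D"
      unfolding \<rho>_def using D\<nu> by (subst AE_density) (auto simp: indicator_def)
    with \<omega>(2) have "AE y in \<rho>. y \<in> D \<and> (\<forall>t\<in>T. (\<lambda>t. X t \<omega> + y t) \<notin> B t)"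
      by eventually_elim simp
    moreover have "ae_filter \<rho> \<noteq> bot"
    proof -
      have "emeasure \<rho> (space \<rho>) = emeasure \<nu> (D \<inter> space \<nu>)"
        unfolding \<rho>_def using D\<nu> by (simp add: emeasure_restricted)
      then show ?thesis using pos by (simp add: ae_filter_eq_bot_iff space_\<nu>)
    qed
    ultimately obtain y where y: "y \<in> D" "\<And>t. t \<in> T \<Longrightarrow> (\<lambda>t. X t \<omega> + y t) \<notin> B t"
      using eventually_happens' by blast
    define u where "u = (\<lambda>t. h (\<lambda>t. X t \<omega> + y t) t - X t \<omega>)"
    have "(\<lambda>t. X t \<omega>) \<in> U" using paths \<omega>(1) by (simp add: paths_in_def)
    then have "u \<in> U" unfolding u_def by (intro diff hU)
    moreover have "u t = y t" if "t \<in> T" for t using y(2)[OF that] by (simp add: u_def B_def)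
    then have "u \<in> D" using T(2)[of u y] y(1) by simp
    ultimately show False using D(2) by blast
  qed
  obtain A :: "nat \<Rightarrow> ('t \<Rightarrow> real) set" where A: "range A \<subseteq> sets \<nu>" "(\<Union>i. A i) = space \<nu>" "\<And>i. emeasure \<nu> (A i) \<noteq> \<infinity>"
    using sigma_finite_measure.sigma_finite[OF \<nu>(2)] by blast
  have "emeasure \<nu> (D \<inter> A i) = 0" for i
  proof (rule finite_case)
    show "D \<inter> A i \<in> sets (cyl UNIV)" using D(1) A(1) unfolding sets_\<nu> by blast
    show "D \<inter> A i \<inter> U = {}" using D(2) by blast
    have "emeasure \<nu> (D \<inter> A i) \<le> emeasure \<nu> (A i)" using A(1) by (intro emeasure_mono) auto
    then show "emeasure \<nu> (D \<inter> A i) < \<infinity>" using A(3)[of i] by (simp add: less_top top_unique order_le_less_trans)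
  qed
  then have "emeasure \<nu> (\<Union>i. D \<inter> A i) = 0"
    using D(1) A(1) unfolding sets_\<nu> by (intro emeasure_UN_eq_0) (auto simp: sets_\<nu>)
  moreover have "(\<Union>i. D \<inter> A i) = D" using A(2) by (auto simp: space_\<nu>)
  ultimately show ?thesis by simp
qed

section \<open>Representations on sets without the zero function\<close>

lemma levy_measure_finite_off_coordinate_ball:
  assumes \<nu>: "levy_measure \<nu>" and r: "r > 0"
  shows "emeasure \<nu> {x. r < \<bar>x t\<bar>} < \<infinity>"
proof -
  define c where "c = min (r\<^sup>2) 1"
  have c: "c > 0" using r by (simp add: c_def)
  have c_le: "c \<le> min (\<bar>x t\<bar>\<^sup>2) 1" if "r < \<bar>x t\<bar>" for x
    using power_mono[of r "\<bar>x t\<bar>" 2] that r by (auto simp: c_def)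
  have S: "{x. r < \<bar>x t\<bar>} \<in> sets \<nu>"
  proof -
    have [measurable]: "(\<lambda>x. x t) \<in> borel_measurable (cyl UNIV)" by (rule measurable_component_singleton) simp
    have "{x \<in> space (cyl UNIV). r < \<bar>x t\<bar>} \<in> sets (cyl UNIV)" by measurable
    then show ?thesis by (simp add: space_cyl levy_measure_sets[OF \<nu>])
  qed
  have "ennreal c * emeasure \<nu> {x. r < \<bar>x t\<bar>} = (\<integral>\<^sup>+x. ennreal c * indicator {x. r < \<bar>x t\<bar>} x \<partial>\<nu>)"
    using S by (simp add: nn_integral_cmult_indicator)
  also have "\<dots> \<le> (\<integral>\<^sup>+x. ennreal (min (\<bar>x t\<bar>\<^sup>2) 1) \<partial>\<nu>)"
    using c_le by (intro nn_integral_mono) (auto simp: indicator_def intro!: ennreal_leI simp del: min_less_iff_conj)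
  also have "\<dots> < \<infinity>" using \<nu> by (simp add: levy_measure_def)
  finally show ?thesis using c by (auto simp: ennreal_mult_less_top less_top[symmetric])
qed

lemma levy_representation_measurable:
  assumes "levy_representation n V \<nu>"
  shows "(\<lambda>s t. V t s) \<in> measurable n (cyl UNIV)"
  by (rule measurable_PiM_single') (use assms in \<open>auto simp: levy_representation_def\<close>)

text \<open>
  A representation is prescribed on finite-dimensional cylinders without the zero function only.
  Let a countable set \<open>T\<close> of coordinates determine \<open>A\<close>. As \<open>A\<close> does not contain the zero function, it is
  covered by the countably many sets \<open>{x. r < \<bar>x t\<bar>}\<close> with \<open>t \<in> T\<close> and rational \<open>r > 0\<close>, each of finite
  measure. Inside the disjoint sets \<open>E i\<close> obtained from them, which depend on finitely many
  coordinates, all finite-dimensional cylinders avoid the zero function, and two finite measures that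
  agree on these coincide.
\<close>

lemma levy_representation_emeasure:
  fixes \<nu> :: "('t \<Rightarrow> real) measure"
  assumes \<nu>: "levy_measure \<nu>" and V: "levy_representation n V \<nu>"
    and A: "A \<in> sets (cyl UNIV)" "(\<lambda>t. 0) \<notin> A"
  shows "emeasure n {s \<in> space n. (\<lambda>t. V t s) \<in> A} = emeasure \<nu> A"
proof -
  note Vm = levy_representation_measurable[OF V]
  note sets_\<nu> = levy_measure_sets[OF \<nu>]
  have space_\<nu>: "space \<nu> = UNIV" using sets_eq_imp_space_eq[OF sets_\<nu>] by (simp add: space_cyl)
  define \<kappa> where "\<kappa> = distr n (cyl UNIV) (\<lambda>s t. V t s)"
  have sets_\<kappa>: "sets \<kappa> = sets (cyl UNIV)" by (simp add: \<kappa>_def)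
  have \<kappa>: "emeasure \<kappa> A = emeasure n {s \<in> space n. (\<lambda>t. V t s) \<in> A}" if "A \<in> sets (cyl UNIV)" for A
    unfolding \<kappa>_def using that by (simp add: emeasure_distr[OF Vm] vimage_def Int_def conj_commute)
  have cylinder: "emeasure \<kappa> {x. restrict x I \<in> B} = emeasure \<nu> {x. restrict x I \<in> B}"
    if I: "finite I" "I \<noteq> {}" and B: "B \<in> sets (cyl I)" "(\<lambda>t\<in>I. 0) \<notin> B" for I B
  proof -
    have "(\<lambda>x. restrict x I) \<in> measurable (cyl UNIV) (cyl I)" by (rule measurable_restrict_subset) simp
    from measurable_sets[OF this B(1)] have "{x. restrict x I \<in> B} \<in> sets (cyl UNIV)"
      by (simp add: space_cyl vimage_def)
    then show ?thesis using V I B by (simp add: \<kappa> levy_representation_def space_\<nu>)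
  qed
  obtain T where T: "countable T" "\<And>x y. (\<And>t. t \<in> T \<Longrightarrow> x t = y t) \<Longrightarrow> x \<in> A \<longleftrightarrow> y \<in> A"
    using cyl_countably_determined[OF A(1)] by blast
  \<comment> \<open>an enumeration of all pairs of a coordinate in \<open>T\<close> and a radius \<open>1 / (k + 1)\<close>\<close>
  define \<tau> where "\<tau> i = from_nat_into T (fst (prod_decode i))" for i
  define r where "r i = 1 / real (Suc (snd (prod_decode i)))" for i
  have r: "r i > 0" for i by (simp add: r_def)
  define C where "C i = {x :: 't \<Rightarrow> real. r i < \<bar>x (\<tau> i)\<bar>}" for i
  have C: "C i \<in> sets (cyl UNIV)" for i
  proof -
    have [measurable]: "(\<lambda>x. x (\<tau> i)) \<in> borel_measurable (cyl UNIV)" by (rule measurable_component_singleton) simp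
    have "{x \<in> space (cyl UNIV). r i < \<bar>x (\<tau> i)\<bar>} \<in> sets (cyl UNIV)" by measurable
    then show ?thesis by (simp add: space_cyl C_def)
  qed
  have A_sub: "A \<subseteq> (\<Union>i. C i)"
  proof
    fix x assume x: "x \<in> A"
    then obtain t where t: "t \<in> T" "x t \<noteq> 0" using T(2)[of x "\<lambda>t. 0"] A(2) by blast
    obtain m where m: "t = from_nat_into T m" using from_nat_into_surj[OF T(1) t(1)] by metis
    obtain k where "1 / real (Suc k) < \<bar>x t\<bar>" using nat_approx_posE[of "\<bar>x t\<bar>"] t(2) by auto
    then have "x \<in> C (prod_encode (m, k))" by (simp add: C_def r_def \<tau>_def m)
    then show "x \<in> (\<Union>i. C i)" by blast
  qed
  define E where "E i = C i - (\<Union>j<i. C j)" for i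
  have E: "E i \<in> sets (cyl UNIV)" for i using C unfolding E_def by blast
  have E_sum: "emeasure M A = (\<Sum>i. emeasure M (E i \<inter> A))" if M: "sets M = sets (cyl UNIV)" for M
  proof -
    have E_eq: "E = disjointed C"
      by (simp add: fun_eq_iff disjointed_def E_def atLeast0LessThan)
    have "(\<Union>i. E i \<inter> A) = (\<Union>i. E i) \<inter> A" by blast
    also have "\<dots> = A" using A_sub by (simp add: E_eq UN_disjointed_eq Int_absorb1)
    finally have UN: "(\<Union>i. E i \<inter> A) = A" .
    have "disjoint_family (\<lambda>i. E i \<inter> A)"
      using disjoint_family_disjointed[of C] unfolding E_eq disjoint_family_on_def by blast
    moreover have "range (\<lambda>i. E i \<inter> A) \<subseteq> sets M" using E A(1) unfolding M by blast
    ultimately show ?thesis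
      using suminf_emeasure[of "\<lambda>i. E i \<inter> A" M] unfolding UN by simp
  qed
  have "density \<kappa> (indicator (E i)) = density \<nu> (indicator (E i))" for i
  proof (rule measure_eqI_PiM_infinite)
    show "sets (density \<kappa> (indicator (E i))) = sets (cyl UNIV)"
      "sets (density \<nu> (indicator (E i))) = sets (cyl UNIV)"
      by (simp_all add: sets_\<kappa> sets_\<nu>)
    have eq: "emeasure \<kappa> (E i \<inter> {x. \<forall>j\<in>J. x j \<in> S j}) = emeasure \<nu> (E i \<inter> {x. \<forall>j\<in>J. x j \<in> S j})"
      if J: "finite J" and S: "\<And>j. j \<in> J \<Longrightarrow> S j \<in> sets borel" for J S
    proof -
      define I where "I = J \<union> \<tau> ` {..i}"
      define B where "B = {y \<in> space (cyl I). r i < \<bar>y (\<tau> i)\<bar> \<and> (\<forall>j\<in>{..<i}. \<not> r j < \<bar>y (\<tau> j)\<bar>) \<and> (\<forall>j\<in>J. y j \<in> S j)}"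
      have I: "finite I" "I \<noteq> {}" "\<And>j. j \<le> i \<Longrightarrow> \<tau> j \<in> I" "J \<subseteq> I" using J by (auto simp: I_def)
      have y: "(\<lambda>y. y t) \<in> borel_measurable (cyl I)" if "t \<in> I" for t
        using that by (rule measurable_component_singleton)
      have "B \<in> sets (cyl I)"
        unfolding B_def
      proof (intro sets.sets_Collect_conj sets.sets_Collect_finite_All sets.sets_Collect_neg)
        show "{y \<in> space (cyl I). r i < \<bar>y (\<tau> i)\<bar>} \<in> sets (cyl I)"
          by (intro borel_measurable_less borel_measurable_const borel_measurable_abs y I(3) order_refl)
        show "{y \<in> space (cyl I). r j < \<bar>y (\<tau> j)\<bar>} \<in> sets (cyl I)" if "j \<in> {..<i}" for j
          using that by (intro borel_measurable_less borel_measurable_const borel_measurable_abs y I(3)) simp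
        show "{y \<in> space (cyl I). y j \<in> S j} \<in> sets (cyl I)" if "j \<in> J" for j
          using measurable_sets[OF y S[OF that]] I(4) that by (auto simp: vimage_def Int_def conj_commute)
      qed (use J in auto)
      moreover have "(\<lambda>t\<in>I. 0) \<notin> B" using r[of i] I(3)[of i] by (auto simp: B_def)
      moreover have "{x. restrict x I \<in> B} = E i \<inter> {x. \<forall>j\<in>J. x j \<in> S j}"
      proof (rule set_eqI)
        fix x :: "'t \<Rightarrow> real"
        have "restrict x I (\<tau> j) = x (\<tau> j)" if "j \<le> i" for j using I(3)[OF that] by simp
        moreover have "restrict x I j = x j" if "j \<in> J" for j using I(4) that by auto
        moreover have "restrict x I \<in> space (cyl I)" by (simp add: space_PiM)
        ultimately show "x \<in> {x. restrict x I \<in> B} \<longleftrightarrow> x \<in> E i \<inter> {x. \<forall>j\<in>J. x j \<in> S j}"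
          unfolding B_def E_def C_def by simp
      qed
      ultimately show ?thesis using cylinder[OF I(1,2), of B] by simp
    qed
    have fin: "emeasure \<nu> (E i) < \<infinity>"
    proof -
      have "emeasure \<nu> (E i) \<le> emeasure \<nu> (C i)" using C by (intro emeasure_mono) (auto simp: E_def sets_\<nu>)
      also have "\<dots> < \<infinity>" unfolding C_def by (rule levy_measure_finite_off_coordinate_ball[OF \<nu> r])
      finally show ?thesis .
    qed
    then show "finite_measure (density \<kappa> (indicator (E i)))"
      using eq[of "{}" "\<lambda>_. {}"] E by (intro finite_measure_restricted_density) (simp_all add: sets_\<kappa>)
    fix S :: "'t \<Rightarrow> real set" and J assume J: "finite J" "J \<subseteq> UNIV" "\<And>j. j \<in> J \<Longrightarrow> S j \<in> sets borel"
    have "prod_emb UNIV (\<lambda>_. borel) J (Pi\<^sub>E J S) = {x. \<forall>j\<in>J. x j \<in> S j}"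
      by (auto simp: prod_emb_def)
    moreover have "prod_emb UNIV (\<lambda>_. borel) J (Pi\<^sub>E J S) \<in> sets (cyl UNIV)"
      using J by (intro sets_PiM_I) auto
    ultimately show "emeasure (density \<kappa> (indicator (E i))) (prod_emb UNIV (\<lambda>_. borel) J (Pi\<^sub>E J S))
      = emeasure (density \<nu> (indicator (E i))) (prod_emb UNIV (\<lambda>_. borel) J (Pi\<^sub>E J S))"
      using eq[OF J(1,3)] E by (simp add: emeasure_restricted sets_\<kappa> sets_\<nu>)
  qed
  then have "emeasure (density \<kappa> (indicator (E i))) A = emeasure (density \<nu> (indicator (E i))) A" for i
    by simp
  then have "emeasure \<kappa> (E i \<inter> A) = emeasure \<nu> (E i \<inter> A)" for i
    using E A(1) by (simp add: emeasure_restricted sets_\<kappa> sets_\<nu>)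
  then have "emeasure \<kappa> A = emeasure \<nu> A" using E_sum[OF sets_\<kappa>] E_sum[OF sets_\<nu>] by simp
  then show ?thesis using \<kappa>[OF A(1)] by simp
qed

section \<open>Transport into the carrier\<close>

text \<open>
  The setting of the following facts: a Levy measure that ignores every measurable set missing
  \<open>U\<close>, and a measurable retraction \<open>h\<close> onto \<open>U\<close>. As \<open>U\<close> need not be measurable in \<open>\<real>\<^sup>T\<close>, the
  retraction is what transports measures and maps into \<open>U\<close>. The set \<open>N\<close> is a measurable
  substitute for \<open>{0}\<close>, which is not measurable when \<open>T\<close> is uncountable.
\<close>

locale levy_measure_on_carrier =
  fixes \<nu> :: "('t \<Rightarrow> real) measure" and U :: "('t \<Rightarrow> real) set"
    and h :: "('t \<Rightarrow> real) \<Rightarrow> ('t \<Rightarrow> real)" and N :: "('t \<Rightarrow> real) set"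
  assumes levy: "levy_measure \<nu>"
    and zero: "(\<lambda>t. 0) \<in> U"
    and h: "h \<in> measurable (cyl UNIV) (restrict_space (cyl UNIV) U)"
    and h_id: "\<And>x. x \<in> U \<Longrightarrow> h x = x"
    and N: "N \<in> sets (cyl UNIV)" "N \<inter> U = {\<lambda>t. 0}"
    and null: "\<And>D. D \<in> sets (cyl UNIV) \<Longrightarrow> D \<inter> U = {} \<Longrightarrow> emeasure \<nu> D = 0"
begin

lemmas sets_\<nu> = levy_measure_sets[OF levy]

lemma space_\<nu>: "space \<nu> = UNIV"
  using sets_eq_imp_space_eq[OF sets_\<nu>] by (simp add: space_cyl)

lemma space_trace: "space (restrict_space (cyl UNIV) U) = U"
  by (simp add: space_restrict_space space_cyl)

lemma h_in_U: "h x \<in> U"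
  using measurable_space[OF h, of x] by (simp add: space_cyl space_trace)

lemma h_measurable_cyl: "h \<in> measurable (cyl UNIV) (cyl UNIV)"
  using h by (rule measurable_restrict_space2_iff[THEN iffD1, THEN conjunct1])

lemma h_preimage_sets: "A \<in> sets (cyl UNIV) \<Longrightarrow> {x. h x \<in> A} \<in> sets (cyl UNIV)"
  using measurable_sets[OF h_measurable_cyl, of A] by (simp add: space_cyl vimage_def)

text \<open>
  The symmetric difference of \<open>A\<close> and \<open>B\<close> misses \<open>U\<close>, so it is a null set.
\<close>

lemma \<nu>_cong:
  assumes A: "A \<in> sets (cyl UNIV)" and B: "B \<in> sets (cyl UNIV)" and AB: "A \<inter> U = B \<inter> U"
  shows "emeasure \<nu> A = emeasure \<nu> B"
proof -
  have le: "emeasure \<nu> A \<le> emeasure \<nu> B"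
    if A: "A \<in> sets (cyl UNIV)" and B: "B \<in> sets (cyl UNIV)" and AB: "A \<inter> U = B \<inter> U" for A B
  proof -
    have "emeasure \<nu> (A - B) = 0" using A B AB by (intro null) auto
    have "emeasure \<nu> A \<le> emeasure \<nu> (B \<union> (A - B))"
      using A B by (intro emeasure_mono) (auto simp: sets_\<nu>)
    also have "\<dots> \<le> emeasure \<nu> B + emeasure \<nu> (A - B)"
      using A B by (intro emeasure_subadditive) (auto simp: sets_\<nu>)
    finally show ?thesis using \<open>emeasure \<nu> (A - B) = 0\<close> by simp
  qed
  show ?thesis using le[OF A B AB] le[OF B A AB[symmetric]] by (rule antisym)
qed

lemma \<nu>_h_preimage:
  assumes "A \<in> sets (cyl UNIV)"
  shows "emeasure \<nu> {x. h x \<in> A} = emeasure \<nu> A"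
  using assms h_id by (intro \<nu>_cong h_preimage_sets) auto

text \<open>
  Here the second defining property of a Levy measure enters: a measurable subset of \<open>N\<close> without
  the zero function misses \<open>U\<close>, so the inner measure that computes \<open>\<nu> N\<close> vanishes.
\<close>

lemma N_null: "emeasure \<nu> N = 0"
proof -
  have "emeasure \<nu> N = inner_measure \<nu> (N - {\<lambda>t. 0})"
    using levy N(1) by (simp add: levy_measure_def)
  also have "\<dots> = 0"
  proof -
    have "emeasure \<nu> D = 0" if "D \<in> sets \<nu>" "D \<subseteq> N - {\<lambda>t. 0}" for D
      using that N(2) by (intro null) (auto simp: sets_\<nu>)
    then show ?thesis unfolding inner_measure_def by (simp add: bot_ennreal[symmetric] SUP_eq_iff)
  qed
  finally show ?thesis .
qed

lemma \<nu>_concentrated: "inner_measure \<nu> (UNIV - U) = 0"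
proof -
  have "emeasure \<nu> D = 0" if "D \<in> sets \<nu>" "D \<subseteq> UNIV - U" for D
    using that by (intro null) (auto simp: sets_\<nu>)
  then show ?thesis unfolding inner_measure_def by (simp add: bot_ennreal[symmetric] SUP_eq_iff)
qed

text \<open>
  The measure \<open>\<nu>\<close> on \<open>U\<close> is realised as the image of \<open>\<nu>\<close> under \<open>h\<close>, which makes countable
  additivity immediate.
\<close>

lemma exact_representation_on_carrier:
  defines "\<nu>U \<equiv> distr \<nu> (restrict_space (cyl UNIV) U) h"
  shows "sets \<nu>U = sets (restrict_space (cyl UNIV) U)"
    and "\<And>A. A \<in> sets (cyl UNIV) \<Longrightarrow> emeasure \<nu>U (A \<inter> U) = emeasure \<nu> A"
    and "exact_levy_representation \<nu>U (\<lambda>t u. u t) \<nu>"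
    and "paths_in \<nu>U (\<lambda>t u. u t) U"
proof -
  let ?R = "restrict_space (cyl UNIV) U"
  have h\<nu>: "h \<in> measurable \<nu> ?R" using h measurable_cong_sets[OF sets_\<nu> refl] by blast
  show sets_U: "sets \<nu>U = sets ?R" by (simp add: \<nu>U_def)
  have space_U: "space \<nu>U = U" by (simp add: \<nu>U_def space_trace)
  show eq: "emeasure \<nu>U (A \<inter> U) = emeasure \<nu> A" if A: "A \<in> sets (cyl UNIV)" for A
  proof -
    have "A \<inter> U \<in> sets ?R" using A by (auto simp: sets_restrict_space)
    then have "emeasure \<nu>U (A \<inter> U) = emeasure \<nu> {x. h x \<in> A}"
      using h_in_U by (simp add: \<nu>U_def emeasure_distr[OF h\<nu>] space_\<nu> vimage_def)
    then show ?thesis using \<nu>_h_preimage[OF A] by simp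
  qed
  have id: "(\<lambda>u. u) \<in> measurable \<nu>U (cyl UNIV)"
    using measurable_restrict_space1[OF measurable_ident] measurable_cong_sets[OF sets_U refl]
    unfolding id_def by blast
  show "exact_levy_representation \<nu>U (\<lambda>t u. u t) \<nu>"
    unfolding exact_levy_representation_def levy_representation_def
  proof (intro conjI allI impI)
    show "(\<lambda>u. u t) \<in> borel_measurable \<nu>U" for t by (rule measurable_compose[OF id measurable_component_singleton]) simp
    fix I :: "'t set" and B assume IB: "finite I \<and> I \<noteq> {} \<and> B \<in> sets (cyl I) \<and> (\<lambda>t\<in>I. 0) \<notin> B"
    have "(\<lambda>x. restrict x I) \<in> measurable (cyl UNIV) (cyl I)" by (rule measurable_restrict_subset) simp
    from measurable_sets[OF this, of B] have "{x. restrict x I \<in> B} \<in> sets (cyl UNIV)"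
      using IB by (simp add: space_cyl vimage_def)
    from eq[OF this] show "emeasure \<nu>U {s \<in> space \<nu>U. (\<lambda>t\<in>I. s t) \<in> B} = emeasure \<nu> {x \<in> space \<nu>. restrict x I \<in> B}"
      by (simp add: space_U space_\<nu> Int_def conj_commute)
  next
    show "distr \<nu>U (cyl UNIV) (\<lambda>s t. s t) = \<nu>"
    proof (rule measure_eqI)
      show "sets (distr \<nu>U (cyl UNIV) (\<lambda>s t. s t)) = sets \<nu>" by (simp add: sets_\<nu>)
      fix A assume "A \<in> sets (distr \<nu>U (cyl UNIV) (\<lambda>s t. s t))"
      then have A: "A \<in> sets (cyl UNIV)" by simp
      then have "emeasure (distr \<nu>U (cyl UNIV) (\<lambda>s. s)) A = emeasure \<nu>U (A \<inter> U)"
        by (simp only: emeasure_distr[OF id A] space_U vimage_ident)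
      then show "emeasure (distr \<nu>U (cyl UNIV) (\<lambda>s t. s t)) A = emeasure \<nu> A"
        using eq[OF A] by simp
    qed
  qed
  show "paths_in \<nu>U (\<lambda>t u. u t) U" by (simp add: paths_in_def space_U)
qed

text \<open>
  The modification is \<open>W = h \<circ> V\<close>. It changes \<open>V t\<close> where \<open>V\<close> falls into \<open>{x. h x t \<noteq> x t}\<close>; that
  set is \<open>\<nu>\<close>-null since it misses \<open>U\<close>, and \<open>n\<close>-null since it does not contain the zero function,
  so that \<open>V\<close> represents its measure. For exactness, a set \<open>A\<close> is replaced by \<open>A - N\<close>: the part
  of the underlying space where \<open>W\<close> lies in \<open>N\<close> is exactly the part where \<open>W\<close> vanishes identically.
\<close>

lemma representation_modification:
  fixes n :: "'s measure"
  assumes V: "levy_representation n V \<nu>"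
  shows "\<exists>W. levy_representation n W \<nu>
             \<and> paths_in n W U
             \<and> (\<forall>t. emeasure n {s \<in> space n. W t s \<noteq> V t s} = 0)
             \<and> nonzero_set n W \<in> sets n
             \<and> exact_levy_representation (restrict_space n (nonzero_set n W)) W \<nu>
             \<and> (exact_levy_representation n V \<nu> \<longrightarrow> exact_levy_representation n W \<nu>)"
proof -
  have h0: "h (\<lambda>t. 0) = (\<lambda>t. 0)" by (rule h_id[OF zero])
  have coord: "(\<lambda>x. x t) \<in> borel_measurable (cyl UNIV)" for t :: 't
    by (rule measurable_component_singleton) simp
  define W where "W t s = h (\<lambda>t. V t s) t" for t s
  have W_path: "(\<lambda>t. W t s) = h (\<lambda>t. V t s)" for s by (simp add: W_def)
  note Vm = levy_representation_measurable[OF V]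
  have Wm: "(\<lambda>s t. W t s) \<in> measurable n (cyl UNIV)"
    unfolding W_path by (rule measurable_compose[OF Vm h_measurable_cyl])
  have W_coord: "W t \<in> borel_measurable n" for t
    using measurable_compose[OF Wm coord[of t]] by simp
  have V_coord: "V t \<in> borel_measurable n" for t using V by (simp add: levy_representation_def)
  have diff_sets: "{s \<in> space n. W t s \<noteq> V t s} \<in> sets n" for t
    by (rule borel_measurable_neq[OF W_coord V_coord])
  have diff_null: "emeasure n {s \<in> space n. W t s \<noteq> V t s} = 0" for t
  proof -
    let ?E = "{x. h x t \<noteq> x t}"
    have "{x \<in> space (cyl UNIV). h x t \<noteq> x t} \<in> sets (cyl UNIV)"
      by (rule borel_measurable_neq[OF measurable_compose[OF h_measurable_cyl coord] coord])
    then have E: "?E \<in> sets (cyl UNIV)" by (simp add: space_cyl)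
    have "emeasure n {s \<in> space n. (\<lambda>t. V t s) \<in> ?E} = emeasure \<nu> ?E"
      by (rule levy_representation_emeasure[OF levy V E]) (simp add: h0)
    also have "\<dots> = 0" using h_id by (intro null E) auto
    finally show ?thesis by (simp add: W_def)
  qed
  have W_rep: "levy_representation n W \<nu>"
    unfolding levy_representation_def
  proof (intro conjI allI impI)
    show "W t \<in> borel_measurable n" for t by (rule W_coord)
    fix I :: "'t set" and B assume IB: "finite I \<and> I \<noteq> {} \<and> B \<in> sets (cyl I) \<and> (\<lambda>t\<in>I. 0) \<notin> B"
    have restr: "(\<lambda>s. \<lambda>t\<in>I. Y t s) \<in> measurable n (cyl I)" if "\<And>t. Y t \<in> borel_measurable n" for Y
      by (rule measurable_restrict) (rule that)
    have "AE s in n. W t s = V t s" for t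
      using diff_null diff_sets by (intro AE_I[of _ _ "{s \<in> space n. W t s \<noteq> V t s}"]) auto
    then have "AE s in n. \<forall>t\<in>I. W t s = V t s" using IB by (intro AE_finite_allI) auto
    then have "AE s in n. s \<in> {s \<in> space n. (\<lambda>t\<in>I. W t s) \<in> B} \<longleftrightarrow> s \<in> {s \<in> space n. (\<lambda>t\<in>I. V t s) \<in> B}"
    proof eventually_elim
      case (elim s)
      then have "(\<lambda>t\<in>I. W t s) = (\<lambda>t\<in>I. V t s)" by (intro restrict_ext) simp
      then show ?case by simp
    qed
    then have "emeasure n {s \<in> space n. (\<lambda>t\<in>I. W t s) \<in> B} = emeasure n {s \<in> space n. (\<lambda>t\<in>I. V t s) \<in> B}"
      using measurable_sets[OF restr, of W B] measurable_sets[OF restr, of V B] W_coord V_coord IB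
      by (intro emeasure_eq_AE) (auto simp: vimage_def Int_def conj_commute)
    also have "\<dots> = emeasure \<nu> {x \<in> space \<nu>. restrict x I \<in> B}"
      using V IB by (simp add: levy_representation_def)
    finally show "emeasure n {s \<in> space n. (\<lambda>t\<in>I. W t s) \<in> B} = emeasure \<nu> {x \<in> space \<nu>. restrict x I \<in> B}" .
  qed
  have in_N: "h x \<in> N \<longleftrightarrow> h x = (\<lambda>t. 0)" for x using N(2) h_in_U[of x] by blast
  have NZ: "nonzero_set n W = {s \<in> space n. h (\<lambda>t. V t s) \<notin> N}"
    by (simp add: nonzero_set_def W_path in_N)
  have NZ_sets: "nonzero_set n W \<in> sets n"
  proof -
    have "(\<lambda>s t. W t s) -` (UNIV - N) \<inter> space n \<in> sets n"
      using sets.compl_sets[OF N(1)] by (intro measurable_sets[OF Wm]) (simp add: space_cyl)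
    also have "(\<lambda>s t. W t s) -` (UNIV - N) \<inter> space n = nonzero_set n W"
      unfolding NZ by (auto simp: W_path)
    finally show ?thesis .
  qed
  let ?n = "restrict_space n (nonzero_set n W)"
  have space_n: "space ?n = nonzero_set n W"
    by (auto simp: space_restrict_space nonzero_set_def)
  have emeasure_n: "emeasure ?n A = emeasure n A" if "A \<subseteq> nonzero_set n W" for A
    using that NZ_sets sets.Int_space_eq2[OF NZ_sets] by (intro emeasure_restrict_space) auto
  have Wm': "(\<lambda>s t. W t s) \<in> measurable ?n (cyl UNIV)"
    by (rule measurable_restrict_space1[OF Wm])
  have exact: "exact_levy_representation ?n W \<nu>"
    unfolding exact_levy_representation_def levy_representation_def
  proof (intro conjI allI impI)
    show "W t \<in> borel_measurable ?n" for t by (rule measurable_restrict_space1[OF W_coord])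
    fix I :: "'t set" and B assume IB: "finite I \<and> I \<noteq> {} \<and> B \<in> sets (cyl I) \<and> (\<lambda>t\<in>I. 0) \<notin> B"
    have "s \<in> nonzero_set n W" if "s \<in> space n" "(\<lambda>t\<in>I. W t s) \<in> B" for s
    proof (rule ccontr)
      assume "s \<notin> nonzero_set n W"
      then have "W t s = 0" for t using that(1) by (auto simp: nonzero_set_def dest: fun_cong)
      then show False using that(2) IB by simp
    qed
    then have eq: "{s \<in> space ?n. (\<lambda>t\<in>I. W t s) \<in> B} = {s \<in> space n. (\<lambda>t\<in>I. W t s) \<in> B}"
      unfolding space_n by (auto simp: nonzero_set_def)
    have "emeasure ?n {s \<in> space ?n. (\<lambda>t\<in>I. W t s) \<in> B} = emeasure n {s \<in> space ?n. (\<lambda>t\<in>I. W t s) \<in> B}"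
      by (rule emeasure_n) (auto simp: space_n)
    then show "emeasure ?n {s \<in> space ?n. (\<lambda>t\<in>I. W t s) \<in> B} = emeasure \<nu> {x \<in> space \<nu>. restrict x I \<in> B}"
      using W_rep IB unfolding eq by (simp add: levy_representation_def)
  next
    show "distr ?n (cyl UNIV) (\<lambda>s t. W t s) = \<nu>"
    proof (rule measure_eqI)
      show "sets (distr ?n (cyl UNIV) (\<lambda>s t. W t s)) = sets \<nu>" by (simp add: sets_\<nu>)
      fix A assume "A \<in> sets (distr ?n (cyl UNIV) (\<lambda>s t. W t s))"
      then have A: "A \<in> sets (cyl UNIV)" by simp
      have AN: "A - N \<in> sets (cyl UNIV)" using A N(1) by blast
      have "(\<lambda>s t. W t s) -` A \<inter> space ?n = {s \<in> space n. (\<lambda>t. W t s) \<in> A - N}"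
        unfolding space_n by (auto simp: NZ W_path)
      then have "emeasure (distr ?n (cyl UNIV) (\<lambda>s t. W t s)) A = emeasure ?n {s \<in> space n. (\<lambda>t. W t s) \<in> A - N}"
        by (simp only: emeasure_distr[OF Wm' A])
      also have "\<dots> = emeasure n {s \<in> space n. (\<lambda>t. W t s) \<in> A - N}"
        by (rule emeasure_n) (auto simp: NZ W_path)
      also have "\<dots> = emeasure \<nu> (A - N)"
        by (rule levy_representation_emeasure[OF levy W_rep AN]) (use N(2) in auto)
      also have "\<dots> = emeasure \<nu> A"
        using A N(1) N_null by (intro emeasure_Diff_null_set) (auto simp: sets_\<nu>)
      finally show "emeasure (distr ?n (cyl UNIV) (\<lambda>s t. W t s)) A = emeasure \<nu> A" .
    qed
  qed
  have preserve: "exact_levy_representation n W \<nu>" if ex: "exact_levy_representation n V \<nu>"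
    unfolding exact_levy_representation_def
  proof
    show "levy_representation n W \<nu>" by (rule W_rep)
    show "distr n (cyl UNIV) (\<lambda>s t. W t s) = \<nu>"
    proof (rule measure_eqI)
      show "sets (distr n (cyl UNIV) (\<lambda>s t. W t s)) = sets \<nu>" by (simp add: sets_\<nu>)
      fix A assume "A \<in> sets (distr n (cyl UNIV) (\<lambda>s t. W t s))"
      then have A: "A \<in> sets (cyl UNIV)" by simp
      have "emeasure (distr n (cyl UNIV) (\<lambda>s t. W t s)) A
        = emeasure (distr n (cyl UNIV) (\<lambda>s t. V t s)) {x. h x \<in> A}"
        using emeasure_distr[OF Wm A] emeasure_distr[OF Vm h_preimage_sets[OF A]]
        by (simp add: W_path vimage_def)
      also have "\<dots> = emeasure \<nu> {x. h x \<in> A}" using ex by (simp add: exact_levy_representation_def)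
      finally show "emeasure (distr n (cyl UNIV) (\<lambda>s t. W t s)) A = emeasure \<nu> A"
        unfolding \<nu>_h_preimage[OF A] .
    qed
  qed
  have "paths_in n W U" by (simp add: paths_in_def W_path h_in_U)
  then show ?thesis using W_rep diff_null NZ_sets exact preserve by blast
qed

end

section \<open>Concentration on the path group and exact representations\<close>

theorem theorem3p4:
  fixes P :: "'w measure"
    and X :: "'t \<Rightarrow> 'w \<Rightarrow> real"
    and \<nu> :: "('t \<Rightarrow> real) measure"
    and U :: "('t \<Rightarrow> real) set"
  assumes "infinitely_divisible_process P X"
    and "levy_measure_of P X \<nu>"
    and "sigma_finite_measure \<nu>"
    and "paths_in P X U"
    and "standard_borel_via TYPE('p::polish_space) (restrict_space (cyl UNIV) U)"
    and "additive_subgroup U"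
  shows "inner_measure \<nu> (UNIV - U) = 0
    \<and> (\<exists>\<nu>U. sets \<nu>U = sets (restrict_space (cyl UNIV) U)
          \<and> (\<forall>A\<in>sets (cyl UNIV). emeasure \<nu>U (A \<inter> U) = emeasure \<nu> A)
          \<and> exact_levy_representation \<nu>U (\<lambda>t u. u t) \<nu>
          \<and> paths_in \<nu>U (\<lambda>t u. u t) U)
    \<and> (\<forall>(n :: 's measure) V. sigma_finite_measure n \<longrightarrow> levy_representation n V \<nu> \<longrightarrow>
          (\<exists>W. levy_representation n W \<nu>
             \<and> paths_in n W U
             \<and> (\<forall>t. emeasure n {s \<in> space n. W t s \<noteq> V t s} = 0)
             \<and> nonzero_set n W \<in> sets n
             \<and> exact_levy_representation (restrict_space n (nonzero_set n W)) W \<nu>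
             \<and> (exact_levy_representation n V \<nu> \<longrightarrow> exact_levy_representation n W \<nu>)))"
proof -
  have zero: "(\<lambda>t. 0) \<in> U" using assms(6) by (simp add: additive_subgroup_def)
  obtain h N where hN: "h \<in> measurable (cyl UNIV) (restrict_space (cyl UNIV) U)"
    "\<And>x. x \<in> U \<Longrightarrow> h x = x" "N \<in> sets (cyl UNIV)" "N \<inter> U = {\<lambda>t. 0}"
    using standard_borel_retraction[OF assms(5) zero] by blast
  interpret levy_measure_on_carrier \<nu> U h N
  proof
    show "levy_measure \<nu>" using assms(2) by (simp add: levy_measure_of_def)
    show "emeasure \<nu> D = 0" if "D \<in> sets (cyl UNIV)" "D \<inter> U = {}" for D
      using assms(1)
      by (intro levy_measure_null_off_subgroup[OF _ _ assms(2,3,4,6) hN(1,2) that])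
        (auto simp: infinitely_divisible_process_def)
  qed (fact zero hN)+
  show ?thesis
    using \<nu>_concentrated exact_representation_on_carrier representation_modification by blast
qed

end
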